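(* Let $p_X$ be a strongly log-concave and differentiable prior density, and take $\hat\delta=\delta$. Then for every $y^\delta\in Y$: (i) the MAP estimation problem $$\min_{x\in X}\ \tfrac12\|Ax-y^\delta\|^2-\delta^2\log p_X(x)$$ is strongly convex, and its first-order optimality condition $$A^\ast A x-\delta^2\,\nabla_x(\log p_X)(x)=A^\ast y^\delta$$ is a sufficient condition for $x$ to be the minimizer $x_{\mathrm{MAP}}$. (ii) In addition, the regularized forward operator $A^\ast A-\delta^2\nabla_x(\log p_X):X\to X$ is invertible, and therefore the reconstruction method given by the minimizer $\varphi_{\mathrm{div}}$ of the divergence-regularized loss $$\mathbb E_{(x,z^\delta)\sim p(x,z^\delta)}\left(\tfrac12\|\varphi(x)-z^\delta\|^2-\hat\delta^2\,\nabla\cdot\varphi(x)\right)$$ is equivalent to MAP estimation, i.e. $\varphi_{\mathrm{div}}^{-1}(A^\ast y^\delta)=x_{\mathrm{MAP}}$ for every $y^\delta\in Y$.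
   Context: $X=\mathbb R^{n_X}$, $Y=\mathbb R^{n_Y}$ with Euclidean inner products; $A:X\to Y$ is linear with adjoint $A^\ast$; $\delta>0$. The prior $p_X:X\to\mathbb R_{>0}$ is an everywhere positive, continuously differentiable probability density; strongly log-concave means that $-\log p_X$ is strongly convex, i.e. $-\log p_X-\tfrac m2\|\cdot\|^2$ is convex for some $m>0$. The joint law $p(x,z^\delta)$ is that of $x\sim p_X$ and $z^\delta=A^\ast(Ax+\eta)$, where $\eta\sim\mathcal N(0,\delta^2 I)$ on $Y$ is independent of $x$; $\nabla\cdot\varphi=\operatorname{tr}\mathrm D\varphi$ is the divergence. Standing assumption: $p_X$ decays sufficiently fast that all expectations involved exist and are finite, including $\mathbb E_{p_X}\|x\|^2$ and $\mathbb E_{p_X}\|\nabla\log p_X(x)\|^2$. The minimizer $\varphi_{\mathrm{div}}$ is taken over unconstrained $\varphi$: up to an additive constant independent of $\varphi$, the loss equals $\mathbb E_{x\sim p_X}\bigl(\tfrac12\|\varphi(x)-(A^\ast A x-\hat\delta^2\nabla_x(\log p_X)(x))\|^2\bigr)$, and $\varphi_{\mathrm{div}}$ is the minimizer of this form over all continuous maps $\varphi:X\to X$ with finite objective. The reconstruction method given by $\varphi_{\mathrm{div}}$ is $y^\delta\mapsto\varphi_{\mathrm{div}}^{-1}(A^\ast y^\delta)$. *)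

theory Defs
  imports "HOL-Probability.Probability"
begin

definition strongly_convex :: "('a::real_inner \<Rightarrow> real) \<Rightarrow> bool" where
  "strongly_convex f \<longleftrightarrow> (\<exists>m>0. convex_on UNIV (\<lambda>x. f x - m / 2 * (norm x)\<^sup>2))"

definition strongly_log_concave :: "('a::real_inner \<Rightarrow> real) \<Rightarrow> bool" where
  "strongly_log_concave p \<longleftrightarrow> strongly_convex (\<lambda>x. - ln (p x))"

(* Meaningful only at points of differentiability, where the gradient exists and is unique. *)
definition grad :: "('a::real_inner \<Rightarrow> real) \<Rightarrow> 'a \<Rightarrow> 'a" where
  "grad f x = (THE D. GDERIV f x :> D)"

definition divergence :: "(real^'n \<Rightarrow> real^'n) \<Rightarrow> real^'n \<Rightarrow> real" where
  "divergence \<phi> x = trace (jacobian \<phi> (at x))"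

definition prior_measure :: "(real^'n \<Rightarrow> real) \<Rightarrow> (real^'n) measure" where
  "prior_measure p = density lborel (\<lambda>x. ennreal (p x))"

(* The centred Gaussian with covariance \<delta>\<^sup>2 I; normal_density takes the standard deviation. *)
definition noise_measure :: "real \<Rightarrow> (real^'m) measure" where
  "noise_measure \<delta> = density lborel (\<lambda>\<eta>. ennreal (\<Prod>i\<in>UNIV. normal_density 0 \<delta> (\<eta> $ i)))"

(* The law of (x, A\<^sup>* (A x + \<eta>)) for independent x and \<eta>. *)
definition joint_law ::
    "(real^'n \<Rightarrow> real^'m) \<Rightarrow> real \<Rightarrow> (real^'n \<Rightarrow> real) \<Rightarrow> ((real^'n) \<times> (real^'n)) measure" where
  "joint_law A \<delta> p =
     distr (prior_measure p \<Otimes>\<^sub>M noise_measure \<delta>) (borel \<Otimes>\<^sub>M borel)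
       (\<lambda>(x, \<eta>). (x, adjoint A (A x + \<eta>)))"

definition map_objective ::
    "(real^'n \<Rightarrow> real^'m) \<Rightarrow> real \<Rightarrow> (real^'n \<Rightarrow> real) \<Rightarrow> real^'m \<Rightarrow> real^'n \<Rightarrow> real" where
  "map_objective A \<delta> p y x = 1 / 2 * (norm (A x - y))\<^sup>2 - \<delta>\<^sup>2 * ln (p x)"

(* arg_min is a choice of minimizer; it is determined once the minimizer is unique. *)
definition x_MAP ::
    "(real^'n \<Rightarrow> real^'m) \<Rightarrow> real \<Rightarrow> (real^'n \<Rightarrow> real) \<Rightarrow> real^'m \<Rightarrow> real^'n" where
  "x_MAP A \<delta> p y = arg_min (map_objective A \<delta> p y) (\<lambda>x. True)"

definition reg_forward ::
    "(real^'n \<Rightarrow> real^'m) \<Rightarrow> real \<Rightarrow> (real^'n \<Rightarrow> real) \<Rightarrow> real^'n \<Rightarrow> real^'n" where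
  "reg_forward A \<delta> p x = adjoint A (A x) - \<delta>\<^sup>2 *\<^sub>R grad (\<lambda>u. ln (p u)) x"

definition div_loss ::
    "(real^'n \<Rightarrow> real^'m) \<Rightarrow> real \<Rightarrow> real \<Rightarrow> (real^'n \<Rightarrow> real) \<Rightarrow> (real^'n \<Rightarrow> real^'n) \<Rightarrow> real" where
  "div_loss A \<delta> \<delta>' p \<phi> =
     (\<integral>(x, z). 1 / 2 * (norm (\<phi> x - z))\<^sup>2 - \<delta>'\<^sup>2 * divergence \<phi> x \<partial>joint_law A \<delta> p)"

(* The smooth maps for which the expectations in the loss exist and are finite, so that the
   Bochner integral in div_loss is not the default value 0. *)
definition div_loss_class ::
    "(real^'n \<Rightarrow> real^'m) \<Rightarrow> real \<Rightarrow> (real^'n \<Rightarrow> real) \<Rightarrow> (real^'n \<Rightarrow> real^'n) set" where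
  "div_loss_class A \<delta> p =
     {\<phi>. (\<forall>x. \<phi> differentiable (at x)) \<and> continuous_on UNIV (\<lambda>x. jacobian \<phi> (at x)) \<and>
         integrable (joint_law A \<delta> p) (\<lambda>(x, z). (norm (\<phi> x - z))\<^sup>2) \<and>
         integrable (joint_law A \<delta> p) (\<lambda>(x, z). divergence \<phi> x)}"

(* The divergence-regularized loss after integration by parts and completion of the square, up
   to an additive constant. It needs no derivatives of \<phi>, so it makes sense for all continuous
   \<phi>; the unconstrained minimization is over these. *)
definition square_loss ::
    "(real^'n \<Rightarrow> real^'m) \<Rightarrow> real \<Rightarrow> (real^'n \<Rightarrow> real) \<Rightarrow> (real^'n \<Rightarrow> real^'n) \<Rightarrow> real" where
  "square_loss A \<delta>' p \<phi> =
     (\<integral>x. 1 / 2 * (norm (\<phi> x - reg_forward A \<delta>' p x))\<^sup>2 \<partial>prior_measure p)"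

definition square_loss_class ::
    "(real^'n \<Rightarrow> real^'m) \<Rightarrow> real \<Rightarrow> (real^'n \<Rightarrow> real) \<Rightarrow> (real^'n \<Rightarrow> real^'n) set" where
  "square_loss_class A \<delta>' p =
     {\<phi>. continuous_on UNIV \<phi> \<and>
         integrable (prior_measure p) (\<lambda>x. 1 / 2 * (norm (\<phi> x - reg_forward A \<delta>' p x))\<^sup>2)}"

definition phi_div ::
    "(real^'n \<Rightarrow> real^'m) \<Rightarrow> real \<Rightarrow> (real^'n \<Rightarrow> real) \<Rightarrow> real^'n \<Rightarrow> real^'n" where
  "phi_div A \<delta>' p = arg_min (square_loss A \<delta>' p) (\<lambda>\<phi>. \<phi> \<in> square_loss_class A \<delta>' p)"

end

theory Submission
  imports Defs
begin

text \<open>The regularized forward operator is, up to the constant \<open>A\<^sup>* y\<close>, the gradient of the strongly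
  convex MAP objective. Tilting a strongly convex function by a linear one keeps it strongly convex,
  and each tilted function has exactly one critical point; hence the gradient is a bijection.
  The divergence loss is reduced to the square loss by integrating out the noise and integrating by
  parts against the prior. The boundary terms are removed with the \<open>C\<^sup>1\<close> cutoffs
  \<open>(max 0 (1 - r\<^sup>2 \<bar>x\<bar>\<^sup>2))\<^sup>2\<close>, \<open>r \<rightarrow> 0\<close>, whose gradients are uniformly bounded and tend to
  zero pointwise. A continuous map at which the square loss vanishes equals the regularized forward
  operator almost everywhere, hence everywhere, because the prior is positive.\<close>

subsection \<open>Strong convexity\<close>

text \<open>Makes the \<open>THE\<close> in \<open>grad\<close> usable: derivatives are unique, and
  a vector is determined by its inner products.\<close>

lemma grad_eqI: "GDERIV f x :> D \<Longrightarrow> grad f x = D"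
  unfolding grad_def
proof (rule the_equality)
  fix E assume "GDERIV f x :> D" "GDERIV f x :> E"
  then have "(\<lambda>h. h \<bullet> E) = (\<lambda>h. h \<bullet> D)"
    unfolding gderiv_def by (rule has_derivative_unique[rotated])
  then have "\<forall>h. h \<bullet> E = h \<bullet> D" by metis
  then show "E = D" by (simp add: vector_eq_ldot)
qed

text \<open>The derivative is a linear functional on a Euclidean space, and
  \<open>adjoint f' 1\<close> is the vector representing it through the inner product.\<close>

lemma differentiable_imp_GDERIV_grad:
  fixes f :: "'a::euclidean_space \<Rightarrow> real"
  assumes "f differentiable (at x)"
  shows "GDERIV f x :> grad f x"
proof -
  obtain f' where f': "(f has_derivative f') (at x)"
    using assms by (auto simp: differentiable_def)
  then have "f' = (\<lambda>h. h \<bullet> adjoint f' 1)"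
    using adjoint_works[OF has_derivative_linear[OF f'], of _ 1] by auto
  then have "GDERIV f x :> adjoint f' 1"
    using f' unfolding gderiv_def by metis
  then show ?thesis by (simp add: grad_eqI)
qed

lemma GDERIV_norm_square: "GDERIV (\<lambda>x. c * (norm x)\<^sup>2) x :> (2 * c) *\<^sub>R x"
  unfolding gderiv_def power2_norm_eq_inner
  by (auto intro!: derivative_eq_intros simp: inner_commute)

text \<open>Restriction to the line through \<open>x\<close> and \<open>y\<close> reduces this to
  the tangent inequality for convex functions of one real variable.\<close>

lemma convex_on_above_tangent:
  assumes f: "convex_on UNIV f" and d: "GDERIV f x :> d"
  shows "f x + d \<bullet> (y - x) \<le> f y"
proof -
  define h where "h t = f (x + t *\<^sub>R (y - x))" for t :: real
  have "convex_on UNIV h"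
  proof (rule convex_onI)
    fix t a b :: real assume t: "0 < t" "t < 1"
    have "x + ((1 - t) *\<^sub>R a + t *\<^sub>R b) *\<^sub>R (y - x) =
        (1 - t) *\<^sub>R (x + a *\<^sub>R (y - x)) + t *\<^sub>R (x + b *\<^sub>R (y - x))"
      by (simp add: algebra_simps)
    then show "h ((1 - t) *\<^sub>R a + t *\<^sub>R b) \<le> (1 - t) * h a + t * h b"
      using convex_onD[OF f, of t "x + a *\<^sub>R (y - x)" "x + b *\<^sub>R (y - x)"] t
      by (simp add: h_def)
  qed simp
  moreover have "(h has_field_derivative d \<bullet> (y - x)) (at 0)"
  proof -
    \<comment> \<open>The base point is spelled \<open>x + 0 *\<^sub>R (y - x)\<close> so that the
      chain rule matches the line at parameter 0.\<close>
    have f': "(f has_derivative (\<lambda>h. h \<bullet> d)) (at (x + 0 *\<^sub>R (y - x)))"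
      using d by (simp add: gderiv_def)
    have "((\<lambda>t::real. x + t *\<^sub>R (y - x)) has_derivative (\<lambda>t. t *\<^sub>R (y - x))) (at 0)"
      by (auto intro!: derivative_eq_intros)
    from has_derivative_compose[OF this f'] show ?thesis
      by (simp add: has_field_derivative_def h_def[abs_def] inner_commute mult_commute_abs)
  qed
  ultimately show ?thesis
    using convex_on_imp_above_tangent[of UNIV h 0 1 "d \<bullet> (y - x)"] by (simp add: h_def)
qed

text \<open>The ordinary tangent inequality holds for \<open>f\<close> minus the quadratic; moving
  the quadratic back leaves exactly \<open>m / 2 * (norm (y - x))\<^sup>2\<close>.\<close>

lemma strongly_convex_above_tangent:
  assumes "strongly_convex f"
  obtains m where "m > 0"
    "\<And>x y d. GDERIV f x :> d \<Longrightarrow> f x + d \<bullet> (y - x) + m / 2 * (norm (y - x))\<^sup>2 \<le> f y"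
proof -
  obtain m where m: "m > 0" "convex_on UNIV (\<lambda>x. f x - m / 2 * (norm x)\<^sup>2)"
    using assms unfolding strongly_convex_def by auto
  have "f x + d \<bullet> (y - x) + m / 2 * (norm (y - x))\<^sup>2 \<le> f y" if d: "GDERIV f x :> d" for x y d
    using convex_on_above_tangent[OF m(2) GDERIV_diff[OF d GDERIV_norm_square], of y]
    unfolding power2_norm_eq_inner by (simp add: algebra_simps inner_commute)
  with m(1) show ?thesis by (rule that)
qed

lemma strongly_convex_add:
  assumes "strongly_convex f" "convex_on UNIV g"
  shows "strongly_convex (\<lambda>x. f x + g x)"
proof -
  obtain m where m: "m > 0" "convex_on UNIV (\<lambda>x. f x - m / 2 * (norm x)\<^sup>2)"
    using assms(1) unfolding strongly_convex_def by auto
  have "convex_on UNIV (\<lambda>x. f x + g x - m / 2 * (norm x)\<^sup>2)"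
    using convex_on_add[OF m(2) assms(2)] by (simp add: algebra_simps)
  with m(1) show ?thesis unfolding strongly_convex_def by auto
qed

lemma strongly_convex_cmult:
  assumes "strongly_convex f" "c > 0"
  shows "strongly_convex (\<lambda>x. c * f x)"
proof -
  obtain m where m: "m > 0" "convex_on UNIV (\<lambda>x. f x - m / 2 * (norm x)\<^sup>2)"
    using assms(1) unfolding strongly_convex_def by auto
  have "convex_on UNIV (\<lambda>x. c * f x - (c * m) / 2 * (norm x)\<^sup>2)"
    using convex_on_cmul[OF _ m(2), of c] \<open>c > 0\<close> by (simp add: algebra_simps)
  then show ?thesis
    unfolding strongly_convex_def using m(1) \<open>c > 0\<close> by (intro exI[of _ "c * m"]) simp
qed

lemma linear_imp_convex_on:
  fixes g :: "'a::real_vector \<Rightarrow> real"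
  assumes "linear g"
  shows "convex_on UNIV g"
  by (rule convex_onI) (simp_all add: linear_add[OF assms] linear_scale[OF assms])

text \<open>At a critical point the linear term of the tangent bound vanishes and the quadratic one
  is positive. This yields both sufficiency of the first-order condition and uniqueness of the
  minimizer.\<close>

lemma strongly_convex_critical_less:
  assumes "strongly_convex f" "GDERIV f x :> 0" "y \<noteq> x"
  shows "f x < f y"
proof -
  obtain m where m: "m > 0"
    "\<And>x y d. GDERIV f x :> d \<Longrightarrow> f x + d \<bullet> (y - x) + m / 2 * (norm (y - x))\<^sup>2 \<le> f y"
    using strongly_convex_above_tangent[OF assms(1)] by metis
  have "m / 2 * (norm (y - x))\<^sup>2 > 0" using m(1) assms(3) by simp
  with m(2)[OF assms(2), of y] show ?thesis by simp
qed

text \<open>The quadratic lower bound at 0 keeps \<open>f\<close> at or above \<open>f 0\<close>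
  outside a ball. A minimum over the compact ball is then global, and the gradient vanishes
  there.\<close>

lemma strongly_convex_critical_exists:
  fixes f :: "'a::euclidean_space \<Rightarrow> real"
  assumes f: "strongly_convex f" and T: "\<And>x. GDERIV f x :> T x"
  shows "\<exists>x. T x = 0"
proof -
  obtain m where m: "m > 0"
    "\<And>x y d. GDERIV f x :> d \<Longrightarrow> f x + d \<bullet> (y - x) + m / 2 * (norm (y - x))\<^sup>2 \<le> f y"
    using strongly_convex_above_tangent[OF f] by metis
  \<comment> \<open>Beyond this radius the quadratic term \<open>m / 2 * (norm y)\<^sup>2\<close>
    dominates the linear one, which is at least \<open>- (norm (T 0) * norm y)\<close>.\<close>
  define r where "r = 2 * norm (T 0) / m"
  have r: "r \<ge> 0" using m(1) by (simp add: r_def)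
  have out: "f 0 \<le> f y" if "norm y > r" for y
  proof -
    have "norm (T 0) \<le> m / 2 * norm y"
      using that m(1) by (simp add: r_def field_simps)
    then have "norm (T 0) * norm y \<le> m / 2 * (norm y)\<^sup>2"
      by (metis mult.assoc mult_right_mono norm_ge_zero power2_eq_square)
    moreover have "- (norm (T 0) * norm y) \<le> T 0 \<bullet> y"
      using Cauchy_Schwarz_ineq2[of "T 0" y] by linarith
    ultimately show ?thesis using m(2)[OF T[of 0], of y] by simp
  qed
  have "continuous_on (cball 0 r) f"
    using T unfolding gderiv_def
    by (meson continuous_at_imp_continuous_on has_derivative_continuous)
  then obtain x where x: "x \<in> cball 0 r" "\<forall>y\<in>cball 0 r. f x \<le> f y"
    using continuous_attains_inf[of "cball 0 r" f] r by auto
  \<comment> \<open>The ball contains 0, so \<open>f x \<le> f 0 \<le> f y\<close> outside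
    it.\<close>
  have "f x \<le> f y" for y
    using x(2)[rule_format, of y] x(2)[rule_format, of 0] out[of y] r
    by (cases "norm y \<le> r") (auto simp: dist_norm)
  then have "(\<lambda>h. h \<bullet> T x) = (\<lambda>h. 0)"
    using differential_zero_maxmin[of x UNIV f] T[of x] by (simp add: gderiv_def)
  then have "T x \<bullet> T x = 0" by metis
  then show ?thesis by auto
qed

lemma strongly_convex_bij_gradient:
  fixes f :: "'a::euclidean_space \<Rightarrow> real"
  assumes f: "strongly_convex f" and T: "\<And>x. GDERIV f x :> T x"
  shows "bij T"
proof -
  \<comment> \<open>Subtracting the linear function with gradient \<open>w\<close> turns the
    equation \<open>T x = w\<close> into a critical point equation.\<close>
  have tilt: "strongly_convex (\<lambda>x. f x + x \<bullet> (- w))" for w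
    by (intro strongly_convex_add[OF f] linear_imp_convex_on linearI) (simp_all add: algebra_simps)
  have "GDERIV (\<lambda>x. x \<bullet> (- w)) x :> - w" for w x :: 'a
    unfolding gderiv_def by (auto intro!: derivative_eq_intros)
  from GDERIV_add[OF T this] have deriv: "GDERIV (\<lambda>x. f x + x \<bullet> (- w)) x :> T x - w" for w x
    by simp
  show ?thesis
  proof (rule bijI)
    show "inj T"
    proof (rule injI, rule ccontr)
      \<comment> \<open>Two distinct solutions for the same \<open>w\<close> would each have a
        strictly smaller tilted value than the other.\<close>
      fix x y assume "T x = T y" "x \<noteq> y"
      then show False
        using strongly_convex_critical_less[OF tilt[of "T x"], of x y]
          strongly_convex_critical_less[OF tilt[of "T x"], of y x]
          deriv[of "T x" x] deriv[of "T x" y] by simp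
    qed
    show "surj T"
      using strongly_convex_critical_exists[OF tilt deriv] by (metis eq_iff_diff_eq_0 surjI)
  qed
qed

text \<open>The equivalence, rather than mere minimality of \<open>x\<close>, lets the choice in
  \<open>arg_min\<close> collapse to a single point.\<close>

lemma is_arg_min_unique_critical:
  fixes f :: "'a::euclidean_space \<Rightarrow> real"
  assumes f: "strongly_convex f" and x: "GDERIV f x :> 0"
  shows "is_arg_min f (\<lambda>_. True) y \<longleftrightarrow> y = x"
  using strongly_convex_critical_less[OF f x]
  by (metis is_arg_min_def order_less_asym)

lemma arg_min_eq_critical:
  fixes f :: "'a::euclidean_space \<Rightarrow> real"
  assumes f: "strongly_convex f" and x: "GDERIV f x :> 0"
  shows "arg_min f (\<lambda>_. True) = x"
  unfolding arg_min_def is_arg_min_unique_critical[OF assms] by simp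

section \<open>Convexity and gradient of the MAP objective\<close>

lemma convex_on_norm_square_affine:
  fixes A :: "'a::real_vector \<Rightarrow> 'b::real_inner"
  assumes "linear A"
  shows "convex_on UNIV (\<lambda>x. 1 / 2 * (norm (A x - y))\<^sup>2)"
proof (rule convex_onI)
  fix t u v assume t: "0 < (t::real)" "t < 1"
  define a b where "a = A u - y" and "b = A v - y"
  have "A ((1 - t) *\<^sub>R u + t *\<^sub>R v) - y = (1 - t) *\<^sub>R a + t *\<^sub>R b"
    by (simp add: a_def b_def linear_add[OF assms] linear_diff[OF assms] linear_scale[OF assms] algebra_simps)
  \<comment> \<open>The convexity defect of the squared norm is itself a nonnegative multiple of a
    squared norm.\<close>
  moreover have "(1 - t) * (norm a)\<^sup>2 + t * (norm b)\<^sup>2 - (norm ((1 - t) *\<^sub>R a + t *\<^sub>R b))\<^sup>2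
      = t * (1 - t) * (norm (a - b))\<^sup>2"
    unfolding power2_norm_eq_inner
    by (simp only: inner_diff_left inner_diff_right inner_add_left inner_add_right
        inner_scaleR_left inner_scaleR_right inner_commute[of b a]) (simp add: algebra_simps)
  moreover have "t * (1 - t) * (norm (a - b))\<^sup>2 \<ge> 0" using t by simp
  ultimately show "1 / 2 * (norm (A ((1 - t) *\<^sub>R u + t *\<^sub>R v) - y))\<^sup>2
      \<le> (1 - t) * (1 / 2 * (norm (A u - y))\<^sup>2) + t * (1 / 2 * (norm (A v - y))\<^sup>2)"
    by (simp add: a_def b_def)
qed simp

lemma GDERIV_norm_square_affine:
  fixes A :: "'a::euclidean_space \<Rightarrow> 'b::euclidean_space"
  assumes "linear A"
  shows "GDERIV (\<lambda>x. 1 / 2 * (norm (A x - y))\<^sup>2) x :> adjoint A (A x) - adjoint A y"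
proof -
  have "(A has_derivative A) (at x)"
    using assms by (simp add: linear_linear linear_imp_has_derivative)
  then show ?thesis
    unfolding gderiv_def power2_norm_eq_inner
    by (auto intro!: derivative_eq_intros
        simp: adjoint_works[OF assms] inner_simps inner_commute algebra_simps)
qed

text \<open>The modulus comes from the log prior scaled by \<open>\<delta>\<^sup>2\<close>; the data
  term contributes only convexity, since \<open>A\<close> may have a kernel.\<close>

lemma strongly_convex_map_objective:
  assumes "linear A" "\<delta> > 0" "strongly_log_concave p"
  shows "strongly_convex (map_objective A \<delta> p y)"
proof -
  have "strongly_convex (\<lambda>x. \<delta>\<^sup>2 * - ln (p x) + 1 / 2 * (norm (A x - y))\<^sup>2)"
    using assms unfolding strongly_log_concave_def
    by (intro strongly_convex_add strongly_convex_cmult convex_on_norm_square_affine) auto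
  then show ?thesis
    by (rule back_subst[of strongly_convex]) (simp add: map_objective_def fun_eq_iff)
qed

text \<open>Expresses the score, the gradient of log p, as \<open>grad p\<close> divided by
  \<open>p\<close>, from which its continuity is later read off.\<close>

lemma GDERIV_ln:
  assumes "p differentiable (at x)" "p x > (0::real)"
  shows "GDERIV (\<lambda>u. ln (p u)) x :> (1 / p x) *\<^sub>R grad p (x::'a::euclidean_space)"
  using GDERIV_DERIV_compose[OF differentiable_imp_GDERIV_grad[OF assms(1)], of ln "1 / p x"]
    assms(2) DERIV_ln_divide by blast

lemma GDERIV_map_objective:
  assumes "linear A" "p differentiable (at x)" "p x > 0"
  shows "GDERIV (map_objective A \<delta> p y) x :> reg_forward A \<delta> p x - adjoint A y"
proof -
  have 1: "GDERIV (\<lambda>u. ln (p u)) x :> grad (\<lambda>u. ln (p u)) x"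
    using grad_eqI[OF GDERIV_ln[OF assms(2,3)]] GDERIV_ln[OF assms(2,3)] by simp
  have "GDERIV (\<lambda>u. \<delta>\<^sup>2 * ln (p u)) x :> \<delta>\<^sup>2 *\<^sub>R grad (\<lambda>u. ln (p u)) x"
    using GDERIV_mult[OF GDERIV_const 1, of "\<delta>\<^sup>2"] by simp
  from GDERIV_diff[OF GDERIV_norm_square_affine[OF assms(1)] this, of y]
  show ?thesis by (simp add: map_objective_def[abs_def] reg_forward_def algebra_simps)
qed

subsection \<open>Integration by parts against the prior\<close>

text \<open>The affine change of variables with scaling factor 1 is a pure translation, with density
  1.\<close>

lemma lborel_integral_translation:
  fixes f :: "'a::euclidean_space \<Rightarrow> real"
  assumes "f \<in> borel_measurable borel"
  shows "(\<integral>x. f (x + a) \<partial>lborel) = (\<integral>x. f x \<partial>lborel)"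
proof -
  have "(lborel::'a measure) = distr lborel borel (\<lambda>x. a + 1 *\<^sub>R x)"
    using lborel_affine[of 1 a] by (simp add: density_1)
  then have "(\<integral>x. f x \<partial>lborel) = (\<integral>x. f x \<partial>distr lborel borel (\<lambda>x. a + 1 *\<^sub>R x))"
    by metis
  also have "\<dots> = (\<integral>x. f (x + a) \<partial>lborel)"
    using assms by (subst integral_distr) (auto simp: add.commute)
  finally show ?thesis by simp
qed

lemma integrable_lborel_translation:
  fixes f :: "'a::euclidean_space \<Rightarrow> real"
  assumes "integrable lborel f"
  shows "integrable lborel (\<lambda>x. f (x + a))"
proof -
  have "(lborel::'a measure) = distr lborel borel (\<lambda>x. a + 1 *\<^sub>R x)"
    using lborel_affine[of 1 a] by (simp add: density_1)
  then have "integrable (distr lborel borel (\<lambda>x. a + 1 *\<^sub>R x)) f"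
    using assms by metis
  then show ?thesis
    by (subst (asm) integrable_distr_eq)
      (auto simp: add.commute borel_measurable_integrable[OF assms, simplified])
qed

lemma integrable_continuous_compact_support:
  fixes f :: "'a::euclidean_space \<Rightarrow> real"
  assumes "continuous_on UNIV f" "\<And>x. norm x > R \<Longrightarrow> f x = 0"
  shows "integrable lborel f"
proof -
  have "integrable lborel (\<lambda>x. indicator (cball 0 R) x *\<^sub>R f x)"
    by (rule borel_integrable_compact) (auto intro: continuous_on_subset[OF assms(1)])
  also have "(\<lambda>x. indicator (cball 0 R) x *\<^sub>R f x) = f"
    using assms(2) by (auto simp: fun_eq_iff indicator_def)
  finally show ?thesis .
qed

text \<open>Outside the closed ball \<open>g\<close> vanishes on a whole neighbourhood, so its
  derivative is that of the zero function.\<close>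

lemma directional_derivative_zero_outside:
  fixes g :: "'a::real_normed_vector \<Rightarrow> 'b::real_normed_vector"
  assumes g: "(g has_derivative g') (at x)"
    and supp: "\<And>x. norm x > R \<Longrightarrow> g x = 0" and x: "norm x > R"
  shows "g' e = 0"
proof -
  have "open {x::'a. norm x > R}" by (intro open_Collect_less continuous_intros)
  moreover have "((\<lambda>_. 0) has_derivative (\<lambda>_. 0)) (at x)" by simp
  ultimately have "(g has_derivative (\<lambda>_. 0)) (at x)"
    using x supp has_derivative_transform_within_open[of "\<lambda>_. 0" "\<lambda>_. 0" x UNIV _ g] by auto
  then show ?thesis using g has_derivative_unique by metis
qed

text \<open>Translating \<open>g\<close> along \<open>e\<close> leaves its integral unchanged; the derivative in the translation
  parameter may be taken under the integral sign.\<close>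

lemma integral_directional_derivative_eq_0:
  fixes g :: "'a::euclidean_space \<Rightarrow> real"
  assumes g: "\<And>x. (g has_derivative g' x) (at x)"
    and cont: "continuous_on UNIV (\<lambda>x. g' x e)"
    and supp: "\<And>x. norm x > R \<Longrightarrow> g x = 0"
  shows "integrable lborel (\<lambda>x. g' x e)" "(\<integral>x. g' x e \<partial>lborel) = 0"
proof -
  have supp': "g' x e = 0" if "norm x > R" for x
    using directional_derivative_zero_outside[OF g supp that] .
  show "integrable lborel (\<lambda>x. g' x e)"
    by (rule integrable_continuous_compact_support[OF cont supp'])
  have gcont: "continuous_on UNIV g"
    using g by (meson continuous_at_imp_continuous_on has_derivative_continuous)
  have gint: "integrable lborel g"
    by (rule integrable_continuous_compact_support[OF gcont supp])
  have gmeas: "g \<in> borel_measurable borel" using gcont by (rule borel_measurable_continuous_onI)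
  obtain B where B: "\<And>x. norm (g' x e) \<le> B"
  proof -
    have "compact ((\<lambda>x. g' x e) ` cball 0 R)"
      by (intro compact_continuous_image continuous_on_subset[OF cont]) auto
    then obtain B where "\<forall>y\<in>(\<lambda>x. g' x e) ` cball 0 R. norm y \<le> B"
      by (meson bounded_iff compact_imp_bounded)
    \<comment> \<open>For negative \<open>R\<close> the ball is empty and \<open>B\<close> may be
      negative; the maximum with 0 covers the points outside the ball.\<close>
    then have "norm (g' x e) \<le> max B 0" for x
      using supp'[of x] by (cases "norm x > R") (simp_all add: le_max_iff_disj dist_norm)
    then show ?thesis by (rule that)
  qed
  have line: "((\<lambda>t. g (x + t *\<^sub>R e)) has_derivative (\<lambda>t. t * g' (x + s *\<^sub>R e) e)) (at s)" for x s
  proof -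
    have 1: "((\<lambda>t. x + t *\<^sub>R e) has_derivative (\<lambda>t. t *\<^sub>R e)) (at s)"
      by (auto intro!: derivative_eq_intros)
    have "linear (g' (x + s *\<^sub>R e))" by (rule has_derivative_linear[OF g])
    then show ?thesis
      using has_derivative_compose[OF 1 g] by (simp add: linear_scale)
  qed
  \<comment> \<open>The step sizes tend to 0 and stay at most 1, so every difference quotient is
    supported in the ball of radius \<open>R + norm e\<close>.\<close>
  define h :: "nat \<Rightarrow> real" where "h i = 1 / Suc i" for i
  have h: "0 < h i" "h i \<le> 1" for i by (auto simp: h_def)
  define q where "q i x = (g (x + h i *\<^sub>R e) - g x) / h i" for i x
  have "(\<lambda>i. \<integral>x. q i x \<partial>lborel) \<longlonglongrightarrow> (\<integral>x. g' x e \<partial>lborel)"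
  proof (rule integral_dominated_convergence)
    show "(\<lambda>x. g' x e) \<in> borel_measurable lborel"
      using borel_measurable_continuous_onI[OF cont] by simp
    have "continuous_on UNIV (q i)" for i
      unfolding q_def using h[of i]
      by (intro continuous_intros continuous_on_compose2[OF gcont]) auto
    then show "q i \<in> borel_measurable lborel" for i
      by (simp add: borel_measurable_continuous_onI)
    have "integrable lborel (\<lambda>x. indicator (cball 0 (R + norm e)) x *\<^sub>R B)"
      by (rule borel_integrable_compact) auto
    then show "integrable lborel (\<lambda>x::'a. indicator (cball 0 (R + norm e)) x * B)"
      by simp
    show "AE x in lborel. (\<lambda>i. q i x) \<longlonglongrightarrow> g' x e"
    proof (rule AE_I2)
      fix x
      have "((\<lambda>t. g (x + t *\<^sub>R e)) has_field_derivative g' x e) (at 0)"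
        using line[of x 0] by (simp add: has_field_derivative_def mult.commute mult_commute_abs)
      then have "((\<lambda>t. (g (x + t *\<^sub>R e) - g x) / t) \<longlongrightarrow> g' x e) (at 0)"
        by (simp add: has_field_derivative_iff)
      moreover have "filterlim h (at 0) sequentially"
        unfolding filterlim_at
      proof
        show "h \<longlonglongrightarrow> 0"
          unfolding h_def inverse_eq_divide[symmetric] by (rule LIMSEQ_inverse_real_of_nat)
        show "\<forall>\<^sub>F i in sequentially. h i \<in> UNIV \<and> h i \<noteq> 0"
          using h(1) by (intro always_eventually) (simp add: less_imp_neq[symmetric])
      qed
      ultimately show "(\<lambda>i. q i x) \<longlonglongrightarrow> g' x e"
        unfolding q_def by (rule filterlim_compose)
    qed
    fix i
    show "AE x in lborel. norm (q i x) \<le> indicator (cball 0 (R + norm e)) x * B"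
    proof (rule AE_I2)
      fix x :: 'a
      show "norm (q i x) \<le> indicator (cball 0 (R + norm e)) x * B"
      proof (cases "norm x \<le> R + norm e")
        case True
        \<comment> \<open>The mean value theorem writes the difference quotient as a directional
          derivative at an intermediate point, hence bounded by \<open>B\<close> for every
          \<open>i\<close>.\<close>
        have "\<exists>s\<in>{0<..<h i}. g (x + h i *\<^sub>R e) - g (x + 0 *\<^sub>R e) = (h i - 0) * g' (x + s *\<^sub>R e) e"
          using h(1)[of i] has_derivative_at_withinI[OF line] by (rule mvt_simple)
        then obtain s where "g (x + h i *\<^sub>R e) - g x = h i * g' (x + s *\<^sub>R e) e" by auto
        then have "q i x = g' (x + s *\<^sub>R e) e" using h[of i] by (simp add: q_def)
        then show ?thesis using True B by (simp add: dist_norm)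
      next
        case False
        \<comment> \<open>Outside the enlarged ball both \<open>x\<close> and its translate lie
          beyond radius \<open>R\<close>, so the quotient is 0.\<close>
        have "norm (h i *\<^sub>R e) \<le> norm e" using h[of i] by (simp add: mult_left_le_one_le)
        then have "norm (x + h i *\<^sub>R e) > R"
          using False norm_triangle_ineq4[of "x + h i *\<^sub>R e" "h i *\<^sub>R e"] by simp
        moreover have "norm x > R" using False norm_ge_zero[of e] by linarith
        ultimately show ?thesis using False supp by (simp add: q_def dist_norm)
      qed
    qed
  qed
  moreover have "(\<integral>x. q i x \<partial>lborel) = 0" for i
  proof -
    have "(\<integral>x. g (x + h i *\<^sub>R e) - g x \<partial>lborel) = 0"
      using integrable_lborel_translation[OF gint] gint
      by (simp add: lborel_integral_translation[OF gmeas])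
    then show ?thesis unfolding q_def by simp
  qed
  ultimately show "(\<integral>x. g' x e \<partial>lborel) = 0"
    by (simp add: LIMSEQ_const_iff)
qed

text \<open>Each summand is the derivative of one component along its own axis, so it integrates to
  zero separately; the sum is the trace of \<open>V' x\<close>.\<close>

lemma integral_divergence_eq_0:
  fixes V :: "real^'n \<Rightarrow> real^'n"
  assumes V: "\<And>x. (V has_derivative V' x) (at x)"
    and cont: "\<And>e. continuous_on UNIV (\<lambda>x. V' x e)"
    and supp: "\<And>x. norm x > R \<Longrightarrow> V x = 0"
  shows "(\<integral>x. (\<Sum>i\<in>UNIV. V' x (axis i 1) $ i) \<partial>lborel) = 0"
proof -
  have comp: "((\<lambda>x. V x $ i) has_derivative (\<lambda>h. V' x h $ i)) (at x)" for i x
    using bounded_linear.has_derivative[OF bounded_linear_vec_nth V] .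
  have comp_cont: "continuous_on UNIV (\<lambda>x. V' x e $ i)" for e i
    by (intro continuous_intros cont)
  note zero = integral_directional_derivative_eq_0[OF comp comp_cont, of R]
  show ?thesis
    using zero supp by (subst Bochner_Integration.integral_sum) simp_all
qed

section \<open>Divergence, cutoffs and the weighted integration by parts\<close>

lemma divergence_eq_sum_axis:
  "divergence \<phi> x = (\<Sum>i\<in>UNIV. frechet_derivative \<phi> (at x) (axis i 1) $ i)"
  by (simp add: divergence_def trace_def jacobian_def matrix_def)

text \<open>Assembles the term <grad u, V> of the product rule div (u V) = u div V + <grad u, V>
  from its coordinates.\<close>

lemma sum_inner_axis:
  fixes d v :: "real^'n"
  shows "(\<Sum>i\<in>UNIV. (axis i 1 \<bullet> d) * v $ i) = d \<bullet> v"
proof -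
  have "axis i 1 \<bullet> d = d $ i" for i by (simp add: inner_axis')
  then show ?thesis by (simp add: inner_vec_def)
qed

text \<open>Squaring the positive part removes its kink: the derivative is
  \<open>2 * max 0 s\<close>, and the chain rule does the rest.\<close>

lemma GDERIV_cutoff:
  "GDERIV (\<lambda>x. (max 0 (1 - r\<^sup>2 * (norm x)\<^sup>2))\<^sup>2) x :>
     (- 4 * r\<^sup>2 * max 0 (1 - r\<^sup>2 * (norm x)\<^sup>2)) *\<^sub>R x"
proof -
  have square: "((\<lambda>s::real. (max 0 s)\<^sup>2) has_field_derivative 2 * max 0 s) (at s)" for s
  proof (cases s "0::real" rule: linorder_cases)
    case less
    show ?thesis
      by (rule has_field_derivative_transform_within_open[of "\<lambda>_. 0" _ _ "{..<0}"])
        (use less in auto)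
  next
    case greater
    have "((\<lambda>s::real. s\<^sup>2) has_field_derivative 2 * max 0 s) (at s)"
      using greater by (auto intro!: derivative_eq_intros)
    then show ?thesis
      by (rule has_field_derivative_transform_within_open[of _ _ _ "{0<..}"])
        (use greater in auto)
  next
    case equal
    have "((\<lambda>h::real. (max 0 h)\<^sup>2 / h) \<longlongrightarrow> 0) (at 0)"
    proof (rule Lim_null_comparison)
      \<comment> \<open>At h = 0 the quotient is 0 by the convention for division, so the bound
        holds for every h.\<close>
      show "\<forall>\<^sub>F h in at (0::real). norm ((max 0 h)\<^sup>2 / h) \<le> \<bar>h\<bar>"
        by (rule always_eventually) (auto simp: max_def power2_eq_square)
    qed (auto intro!: tendsto_eq_intros)
    then show ?thesis using equal by (simp add: has_field_derivative_iff)
  qed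
  have "GDERIV (\<lambda>x. 1 - r\<^sup>2 * (norm x)\<^sup>2) x :> (- 2 * r\<^sup>2) *\<^sub>R x"
    using GDERIV_diff[OF GDERIV_const GDERIV_norm_square, of 1 "r\<^sup>2" x] by simp
  from GDERIV_DERIV_compose[OF this square] show ?thesis
    by (simp add: algebra_simps)
qed

text \<open>On the support \<open>r * norm x \<le> 1\<close>, so one factor \<open>r\<close> absorbs
  \<open>norm x\<close> and the other is at most 1. The bound does not depend on \<open>r\<close>,
  as dominated convergence requires.\<close>

lemma norm_grad_cutoff_le:
  assumes "0 < r" "r \<le> 1"
  shows "norm ((- 4 * r\<^sup>2 * max 0 (1 - r\<^sup>2 * (norm x)\<^sup>2)) *\<^sub>R x) \<le> 4"
proof (cases "r * norm x \<le> 1")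
  case True
  define m where "m = max 0 (1 - r\<^sup>2 * (norm x)\<^sup>2)"
  have m: "0 \<le> m" "m \<le> 1" by (auto simp: m_def)
  have "r * m \<le> 1"
    using assms m by (intro mult_le_one) auto
  then have "r * m * (r * norm x) \<le> 1 * 1"
    using assms m True by (intro mult_mono[of "r * m" 1 "r * norm x" 1]) auto
  moreover have "norm ((- 4 * r\<^sup>2 * m) *\<^sub>R x) = 4 * (r * m * (r * norm x))"
    using m by (simp add: abs_mult power2_eq_square)
  ultimately have "norm ((- 4 * r\<^sup>2 * m) *\<^sub>R x) \<le> 4" by linarith
  then show ?thesis unfolding m_def .
next
  case False
  then have "1 < (r * norm x)\<^sup>2" by (simp add: one_less_power)
  then show ?thesis by (simp add: power_mult_distrib max_def)
qed

lemma continuous_on_frechet_derivative: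
  fixes \<phi> :: "real^'n \<Rightarrow> real^'m"
  assumes "\<And>x. \<phi> differentiable (at x)" "continuous_on UNIV (\<lambda>x. jacobian \<phi> (at x))"
  shows "continuous_on UNIV (\<lambda>x. frechet_derivative \<phi> (at x) e)"
proof -
  have "frechet_derivative \<phi> (at x) = (\<lambda>h. jacobian \<phi> (at x) *v h)" for x
    using assms(1)[of x] unfolding jacobian_works by (rule frechet_derivative_at[symmetric])
  then show ?thesis
    by (simp add: matrix_vector_mult_def) (intro continuous_intros assms(2))
qed

lemma continuous_on_divergence:
  fixes \<phi> :: "real^'n \<Rightarrow> real^'n"
  assumes "\<And>x. \<phi> differentiable (at x)" "continuous_on UNIV (\<lambda>x. jacobian \<phi> (at x))"
  shows "continuous_on UNIV (divergence \<phi>)"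
  unfolding divergence_eq_sum_axis[abs_def]
  by (intro continuous_intros continuous_on_frechet_derivative assms)

lemma integral_prior_measure:
  assumes "continuous_on UNIV p" "\<And>x. p x \<ge> 0" "f \<in> borel_measurable borel"
  shows "(\<integral>x. f x \<partial>prior_measure p) = (\<integral>x. p x * f x \<partial>lborel)"
proof -
  have "p \<in> borel_measurable borel" by (rule borel_measurable_continuous_onI[OF assms(1)])
  then show ?thesis
    unfolding prior_measure_def using assms by (subst integral_density) auto
qed

lemma sets_prior_measure[measurable_cong, simp]: "sets (prior_measure p) = sets borel"
  by (simp add: prior_measure_def)

lemma space_prior_measure[simp]: "space (prior_measure p) = UNIV"
  by (simp add: prior_measure_def)

text \<open>Cauchy-Schwarz together with ab \<le> a^2 + b^2 for nonnegative a and b. It lets the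
  cross terms of expanded squares be integrated separately.\<close>

lemma integrable_inner_of_square:
  fixes u v :: "'a \<Rightarrow> 'b::euclidean_space"
  assumes [measurable]: "u \<in> borel_measurable M" "v \<in> borel_measurable M"
    and u: "integrable M (\<lambda>x. (norm (u x))\<^sup>2)" and v: "integrable M (\<lambda>x. (norm (v x))\<^sup>2)"
  shows "integrable M (\<lambda>x. u x \<bullet> v x)"
proof (rule Bochner_Integration.integrable_bound)
  show "integrable M (\<lambda>x. (norm (u x))\<^sup>2 + (norm (v x))\<^sup>2)"
    using u v by (rule Bochner_Integration.integrable_add)
  show "AE x in M. norm (u x \<bullet> v x) \<le> norm ((norm (u x))\<^sup>2 + (norm (v x))\<^sup>2)"
  proof (rule AE_I2)
    fix x
    have "norm (u x \<bullet> v x) \<le> norm (u x) * norm (v x)"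
      using Cauchy_Schwarz_ineq2 by simp
    also have "\<dots> \<le> (norm (u x))\<^sup>2 + (norm (v x))\<^sup>2"
      using sum_squares_bound[of "norm (u x)" "norm (v x)"]
        mult_nonneg_nonneg[OF norm_ge_zero[of "u x"] norm_ge_zero[of "v x"]] by linarith
    finally show "norm (u x \<bullet> v x) \<le> norm ((norm (u x))\<^sup>2 + (norm (v x))\<^sup>2)" by simp
  qed
qed measurable

text \<open>The field \<kappa> p \<phi> has compact support, so its divergence integrates to zero.
  Factoring \<open>p\<close> out of the integrand turns Lebesgue measure into the prior and produces
  the score.\<close>

lemma integral_divergence_cutoff_eq_0:
  fixes p :: "real^'n \<Rightarrow> real" and \<phi> :: "real^'n \<Rightarrow> real^'n"
  assumes p: "\<And>x. GDERIV p x :> p' x" "continuous_on UNIV p'"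
    and ppos: "\<And>x. p x > 0"
    and \<phi>: "\<And>x. \<phi> differentiable (at x)" "continuous_on UNIV (\<lambda>x. jacobian \<phi> (at x))"
    and \<kappa>: "\<And>x. GDERIV \<kappa> x :> \<kappa>' x" "continuous_on UNIV \<kappa>'"
    and supp: "\<And>x. norm x > R \<Longrightarrow> \<kappa> x = 0"
  shows "(\<integral>x. \<kappa> x * (divergence \<phi> x + (1 / p x) *\<^sub>R p' x \<bullet> \<phi> x) + \<kappa>' x \<bullet> \<phi> x \<partial>prior_measure p) = 0"
    (is "integral\<^sup>L _ ?f = 0")
proof -
  define D where "D x = frechet_derivative \<phi> (at x)" for x
  have D: "(\<phi> has_derivative D x) (at x)" for x
    using \<phi>(1) frechet_derivative_works unfolding D_def by blast
  have Dcont: "continuous_on UNIV (\<lambda>x. D x e)" for e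
    unfolding D_def by (rule continuous_on_frechet_derivative[OF \<phi>])
  have c: "continuous_on UNIV p" "continuous_on UNIV \<kappa>" "continuous_on UNIV \<phi>"
    using p(1) \<kappa>(1) D unfolding gderiv_def
    by (meson continuous_at_imp_continuous_on has_derivative_continuous)+
  \<comment> \<open>\<open>E\<close> is the gradient of the product of \<kappa> and
    \<open>p\<close>.\<close>
  define E where "E x = \<kappa> x *\<^sub>R p' x + p x *\<^sub>R \<kappa>' x" for x
  have V: "((\<lambda>x. (\<kappa> x * p x) *\<^sub>R \<phi> x) has_derivative
      (\<lambda>h. (\<kappa> x * p x) *\<^sub>R D x h + (h \<bullet> E x) *\<^sub>R \<phi> x)) (at x)" for x
    using has_derivative_scaleR[OF GDERIV_mult[OF \<kappa>(1) p(1), unfolded gderiv_def] D[of x]]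
    by (simp add: E_def)
  have Vcont: "continuous_on UNIV (\<lambda>x. (\<kappa> x * p x) *\<^sub>R D x e + (e \<bullet> E x) *\<^sub>R \<phi> x)" for e
    unfolding E_def by (intro continuous_intros c Dcont p(2) \<kappa>(2))
  have zero: "(\<integral>x. (\<Sum>i\<in>UNIV. ((\<kappa> x * p x) *\<^sub>R D x (axis i 1) + (axis i 1 \<bullet> E x) *\<^sub>R \<phi> x) $ i) \<partial>lborel) = 0"
    by (rule integral_divergence_eq_0[OF V Vcont, of R]) (simp add: supp)
  have integrand: "(\<Sum>i\<in>UNIV. ((\<kappa> x * p x) *\<^sub>R D x (axis i 1) + (axis i 1 \<bullet> E x) *\<^sub>R \<phi> x) $ i)
      = p x * ?f x" for x
  proof -
    have "(\<Sum>i\<in>UNIV. ((\<kappa> x * p x) *\<^sub>R D x (axis i 1) + (axis i 1 \<bullet> E x) *\<^sub>R \<phi> x) $ i)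
        = \<kappa> x * p x * divergence \<phi> x + E x \<bullet> \<phi> x"
      by (simp add: divergence_eq_sum_axis D_def sum.distrib sum_distrib_left sum_inner_axis)
    also have "\<dots> = p x * ?f x"
      using ppos[of x] by (simp add: E_def inner_simps field_simps)
    finally show ?thesis .
  qed
  have "(\<integral>x. p x * ?f x \<partial>lborel) = 0"
    using zero unfolding integrand .
  moreover have "continuous_on UNIV ?f"
    using ppos by (intro continuous_intros c p(2) \<kappa>(2) continuous_on_divergence \<phi>)
      (metis less_irrefl)
  ultimately show ?thesis
    using integral_prior_measure[OF c(1) less_imp_le[OF ppos], of ?f]
    by (simp add: borel_measurable_continuous_onI)
qed

text \<open>Dominated convergence removes the cutoff; the integrability assumptions on the
  divergence, \<phi> and the score supply the majorant.\<close>

lemma integral_divergence_prior: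
  fixes p :: "real^'n \<Rightarrow> real" and \<phi> :: "real^'n \<Rightarrow> real^'n"
  assumes p: "\<And>x. GDERIV p x :> p' x" "continuous_on UNIV p'"
    and ppos: "\<And>x. p x > 0"
    and \<phi>: "\<And>x. \<phi> differentiable (at x)" "continuous_on UNIV (\<lambda>x. jacobian \<phi> (at x))"
    and prob: "prob_space (prior_measure p)"
    and int_div: "integrable (prior_measure p) (divergence \<phi>)"
    and int_\<phi>: "integrable (prior_measure p) (\<lambda>x. (norm (\<phi> x))\<^sup>2)"
    and int_score: "integrable (prior_measure p) (\<lambda>x. (norm ((1 / p x) *\<^sub>R p' x))\<^sup>2)"
  shows "(\<integral>x. divergence \<phi> x \<partial>prior_measure p)
    = - (\<integral>x. (1 / p x) *\<^sub>R p' x \<bullet> \<phi> x \<partial>prior_measure p)"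
proof -
  interpret prob_space "prior_measure p" by fact
  define s where "s x = (1 / p x) *\<^sub>R p' x" for x
  have c: "continuous_on UNIV p" "continuous_on UNIV \<phi>"
    using p(1) \<phi>(1) unfolding gderiv_def
    by (meson continuous_at_imp_continuous_on has_derivative_continuous differentiable_imp_continuous_within)+
  have scont: "continuous_on UNIV s"
    unfolding s_def using ppos by (intro continuous_intros c p(2)) (metis less_irrefl)
  have [measurable]: "s \<in> borel_measurable borel" "\<phi> \<in> borel_measurable borel"
    using scont c(2) by (auto intro: borel_measurable_continuous_onI)
  have [measurable]: "divergence \<phi> \<in> borel_measurable borel"
    using continuous_on_divergence[OF \<phi>] by (auto intro: borel_measurable_continuous_onI)
  have int_s\<phi>: "integrable (prior_measure p) (\<lambda>x. s x \<bullet> \<phi> x)"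
    by (rule integrable_inner_of_square) (use int_score int_\<phi> in \<open>simp_all add: s_def[symmetric]\<close>)
  \<comment> \<open>The cutoff gradients are bounded by 4, so only the first power of the norm of
    \<phi> enters the majorant; on a probability space square integrability suffices for it.\<close>
  have int_norm: "integrable (prior_measure p) (\<lambda>x. norm (\<phi> x))"
    by (rule square_integrable_imp_integrable) (use int_\<phi> in simp_all)
  \<comment> \<open>The cutoff with parameter \<open>r n\<close> vanishes beyond the reciprocal
    radius \<open>Suc n\<close>.\<close>
  define r where "r n = inverse (real (Suc n))" for n
  have r: "0 < r n" "r n \<le> 1" for n by (auto simp: r_def field_simps)
  have rlim: "r \<longlonglongrightarrow> 0" using LIMSEQ_inverse_real_of_nat by (simp add: r_def[abs_def])
  define \<kappa> where "\<kappa> n x = (max 0 (1 - (r n)\<^sup>2 * (norm x)\<^sup>2))\<^sup>2" for n and x :: "real^'n"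
  define \<kappa>' where "\<kappa>' n x = (- 4 * (r n)\<^sup>2 * max 0 (1 - (r n)\<^sup>2 * (norm x)\<^sup>2)) *\<^sub>R x"
    for n and x :: "real^'n"
  have \<kappa>_deriv: "GDERIV (\<kappa> n) x :> \<kappa>' n x" for n x
    unfolding \<kappa>_def \<kappa>'_def by (rule GDERIV_cutoff)
  have \<kappa>'_cont: "continuous_on UNIV (\<kappa>' n)" for n
    unfolding \<kappa>'_def by (intro continuous_intros)
  have \<kappa>_cont: "continuous_on UNIV (\<kappa> n)" for n
    unfolding \<kappa>_def by (intro continuous_intros)
  have [measurable]: "\<kappa> n \<in> borel_measurable borel" "\<kappa>' n \<in> borel_measurable borel" for n
    using \<kappa>_cont \<kappa>'_cont by (auto intro: borel_measurable_continuous_onI)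
  have \<kappa>_supp: "\<kappa> n x = 0" if "norm x > real (Suc n)" for n x
  proof -
    have "1 < r n * norm x" using that by (simp add: r_def field_simps)
    then have "1 < (r n * norm x)\<^sup>2" by (simp add: one_less_power)
    then show ?thesis by (simp add: \<kappa>_def power_mult_distrib)
  qed
  have \<kappa>_bound: "0 \<le> \<kappa> n x" "\<kappa> n x \<le> 1" for n x
    unfolding \<kappa>_def by (auto intro!: power_le_one)
  have \<kappa>'_bound: "norm (\<kappa>' n x) \<le> 4" for n x
    unfolding \<kappa>'_def by (rule norm_grad_cutoff_le[OF r])
  define f where "f n x = \<kappa> n x * (divergence \<phi> x + s x \<bullet> \<phi> x) + \<kappa>' n x \<bullet> \<phi> x" for n x
  have zero: "(\<integral>x. f n x \<partial>prior_measure p) = 0" for n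
    unfolding f_def s_def
    by (rule integral_divergence_cutoff_eq_0[OF p ppos \<phi> \<kappa>_deriv \<kappa>'_cont \<kappa>_supp])
  have "(\<lambda>n. \<integral>x. f n x \<partial>prior_measure p) \<longlonglongrightarrow> (\<integral>x. divergence \<phi> x + s x \<bullet> \<phi> x \<partial>prior_measure p)"
  proof (rule integral_dominated_convergence)
    show "integrable (prior_measure p) (\<lambda>x. \<bar>divergence \<phi> x\<bar> + \<bar>s x \<bullet> \<phi> x\<bar> + 4 * norm (\<phi> x))"
      using int_div int_s\<phi> int_norm by auto
    show "f n \<in> borel_measurable (prior_measure p)" for n unfolding f_def by measurable
    show "AE x in prior_measure p. (\<lambda>n. f n x) \<longlonglongrightarrow> divergence \<phi> x + s x \<bullet> \<phi> x"
    proof (rule AE_I2)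
      fix x
      \<comment> \<open>Both limits arise by substituting 0 for \<open>r\<close>, where the cutoff
        equals 1 and its gradient 0.\<close>
      have "(\<lambda>n. \<kappa> n x) \<longlonglongrightarrow> (max 0 (1 - 0\<^sup>2 * (norm x)\<^sup>2))\<^sup>2"
        unfolding \<kappa>_def by (intro tendsto_intros rlim)
      moreover have "(\<lambda>n. \<kappa>' n x) \<longlonglongrightarrow> (- 4 * 0\<^sup>2 * max 0 (1 - 0\<^sup>2 * (norm x)\<^sup>2)) *\<^sub>R x"
        unfolding \<kappa>'_def by (intro tendsto_intros rlim)
      ultimately have "(\<lambda>n. f n x) \<longlonglongrightarrow> 1 * (divergence \<phi> x + s x \<bullet> \<phi> x) + 0 \<bullet> \<phi> x"
        unfolding f_def by (intro tendsto_intros) auto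
      then show "(\<lambda>n. f n x) \<longlonglongrightarrow> divergence \<phi> x + s x \<bullet> \<phi> x" by simp
    qed
    fix n
    show "AE x in prior_measure p.
        norm (f n x) \<le> \<bar>divergence \<phi> x\<bar> + \<bar>s x \<bullet> \<phi> x\<bar> + 4 * norm (\<phi> x)"
    proof (rule AE_I2)
      fix x
      have "\<bar>\<kappa> n x * (divergence \<phi> x + s x \<bullet> \<phi> x)\<bar> \<le> \<bar>divergence \<phi> x + s x \<bullet> \<phi> x\<bar>"
        using \<kappa>_bound[of n x] by (simp add: abs_mult mult_left_le_one_le)
      moreover have "\<bar>\<kappa>' n x \<bullet> \<phi> x\<bar> \<le> 4 * norm (\<phi> x)"
        using Cauchy_Schwarz_ineq2 mult_right_mono[OF \<kappa>'_bound[of n x] norm_ge_zero[of "\<phi> x"]]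
        by (rule order_trans)
      ultimately show "norm (f n x) \<le> \<bar>divergence \<phi> x\<bar> + \<bar>s x \<bullet> \<phi> x\<bar> + 4 * norm (\<phi> x)"
        unfolding f_def real_norm_def by linarith
    qed
  qed measurable
  then have "(\<integral>x. divergence \<phi> x + s x \<bullet> \<phi> x \<partial>prior_measure p) = 0"
    by (simp add: zero LIMSEQ_const_iff)
  then show ?thesis
    using int_div int_s\<phi> by (simp add: s_def[symmetric])
qed

subsection \<open>The noise and the two losses\<close>

text \<open>The product formula over \<open>Basis\<close> is transported to the index type along the
  bijection from \<open>i\<close> to \<open>axis i 1\<close>.\<close>

lemma nn_integral_lborel_prod_vec:
  fixes g :: "'m::finite \<Rightarrow> real \<Rightarrow> ennreal"
  assumes [measurable]: "\<And>i. g i \<in> borel_measurable borel"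
  shows "(\<integral>\<^sup>+x. (\<Prod>i\<in>UNIV. g i ((x::real^'m) $ i)) \<partial>lborel) = (\<Prod>i\<in>UNIV. \<integral>\<^sup>+t. g i t \<partial>lborel)"
proof -
  \<comment> \<open>\<open>ix\<close> recovers the index from a basis vector; its values elsewhere
    never enter.\<close>
  define ix :: "real^'m \<Rightarrow> 'm" where "ix b = (THE i. b = axis i 1)" for b
  have ix: "ix (axis i 1) = i" for i by (simp add: ix_def axis_eq_axis)
  have Basis: "(Basis :: (real^'m) set) = range (\<lambda>i. axis i 1)"
    by (auto simp: Basis_vec_def)
  have inj: "inj (\<lambda>i::'m. axis i (1::real))" by (simp add: inj_on_def axis_eq_axis)
  have reindex: "(\<Prod>b\<in>(Basis :: (real^'m) set). h b) = (\<Prod>i\<in>UNIV. h (axis i 1))" for h :: "_ \<Rightarrow> ennreal"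
    unfolding Basis by (subst prod.reindex[OF inj]) simp
  show ?thesis
    using nn_integral_lborel_prod[of "\<lambda>b. g (ix b)"]
    by (simp add: reindex ix inner_axis)
qed

lemma lborel_integral_uminus:
  fixes f :: "'a::euclidean_space \<Rightarrow> 'b::{banach, second_countable_topology}"
  assumes "f \<in> borel_measurable borel"
  shows "(\<integral>x. f (- x) \<partial>lborel) = (\<integral>x. f x \<partial>lborel)"
proof -
  have "(lborel::'a measure) = distr lborel borel (\<lambda>x. 0 + (-1) *\<^sub>R x)"
    using lborel_affine[of "-1" 0] by (simp add: density_1)
  then have "(\<integral>x. f x \<partial>lborel) = (\<integral>x. f x \<partial>distr lborel borel (\<lambda>x. 0 + (-1) *\<^sub>R x))"
    by metis
  also have "\<dots> = (\<integral>x. f (- x) \<partial>lborel)"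
    using assms by (subst integral_distr) auto
  finally show ?thesis by simp
qed

lemma sets_noise_measure[measurable_cong, simp]: "sets (noise_measure \<delta>) = sets borel"
  by (simp add: noise_measure_def)

lemma space_noise_measure[simp]: "space (noise_measure \<delta>) = UNIV"
  by (simp add: noise_measure_def)

lemma noise_density_measurable[measurable]:
  "(\<lambda>\<eta>. \<Prod>i\<in>UNIV. normal_density 0 \<delta> ((\<eta>::real^'m) $ i)) \<in> borel_measurable borel"
proof -
  have "(\<lambda>\<eta>::real^'m. \<eta> $ i) \<in> borel_measurable borel" for i
    by (intro borel_measurable_continuous_onI continuous_intros)
  then have [measurable]: "(\<lambda>\<eta>::real^'m. normal_density 0 \<delta> (\<eta> $ i)) \<in> borel_measurable borel" for i
    by (rule measurable_compose) simp
  show ?thesis by measurable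
qed

text \<open>The coordinates of the noise are independent. In terms of nonnegative integrals the
  formula serves both for the total mass and for showing that second moments are finite.\<close>

lemma nn_integral_noise_measure_prod:
  fixes g :: "'m::finite \<Rightarrow> real \<Rightarrow> real"
  assumes [measurable]: "\<And>i. g i \<in> borel_measurable borel" and nn: "\<And>i t. g i t \<ge> 0"
  shows "(\<integral>\<^sup>+\<eta>. (\<Prod>i\<in>UNIV. ennreal (g i ((\<eta>::real^'m) $ i))) \<partial>noise_measure \<delta>)
    = (\<Prod>i\<in>UNIV. \<integral>\<^sup>+t. ennreal (normal_density 0 \<delta> t * g i t) \<partial>lborel)"
proof -
  have [measurable]: "(\<lambda>\<eta>::real^'m. \<eta> $ i) \<in> borel_measurable borel" for i
    by (intro borel_measurable_continuous_onI continuous_intros)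
  have "(\<integral>\<^sup>+\<eta>. (\<Prod>i\<in>UNIV. ennreal (g i ((\<eta>::real^'m) $ i))) \<partial>noise_measure \<delta>)
      = (\<integral>\<^sup>+\<eta>. (\<Prod>i\<in>UNIV. ennreal (normal_density 0 \<delta> (\<eta> $ i) * g i ((\<eta>::real^'m) $ i))) \<partial>lborel)"
    unfolding noise_measure_def
    by (subst nn_integral_density)
      (auto simp: nn ennreal_mult prod.distrib prod_ennreal[symmetric])
  also have "\<dots> = (\<Prod>i\<in>UNIV. \<integral>\<^sup>+t. ennreal (normal_density 0 \<delta> t * g i t) \<partial>lborel)"
    by (rule nn_integral_lborel_prod_vec) measurable
  finally show ?thesis .
qed

lemma prob_space_noise_measure:
  assumes "\<delta> > 0"
  shows "prob_space (noise_measure \<delta> :: (real^'m) measure)"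
proof
  have "(\<integral>\<^sup>+t. ennreal (normal_density 0 \<delta> t) \<partial>lborel) = 1"
    using assms by (subst nn_integral_eq_integral) auto
  then have "(\<integral>\<^sup>+\<eta>. 1 \<partial>(noise_measure \<delta> :: (real^'m) measure)) = 1"
    using nn_integral_noise_measure_prod[of "\<lambda>(_::'m) _. 1" \<delta>] by simp
  then show "emeasure (noise_measure \<delta> :: (real^'m) measure) (space (noise_measure \<delta>)) = 1"
    by simp
qed

lemma integrable_noise_measure_norm_square:
  assumes "\<delta> > 0"
  shows "integrable (noise_measure \<delta> :: (real^'m) measure) (\<lambda>\<eta>. (norm \<eta>)\<^sup>2)"
proof -
  have [measurable]: "(\<lambda>\<eta>::real^'m. \<eta> $ i) \<in> borel_measurable borel" for i
    by (intro borel_measurable_continuous_onI continuous_intros)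
  have "integrable (noise_measure \<delta> :: (real^'m) measure) (\<lambda>\<eta>. (\<eta> $ j)\<^sup>2)" for j
  proof (rule integrableI_bounded)
    \<comment> \<open>A single squared coordinate is written as a product over all coordinates, with
      factor 1 everywhere except at \<open>j\<close>.\<close>
    define g where "g i t = (if i = j then t\<^sup>2 else 1)" for i :: 'm and t :: real
    have g_prod: "(\<Prod>i\<in>UNIV. ennreal (g i (\<eta> $ i))) = ennreal ((\<eta> $ j)\<^sup>2)" for \<eta> :: "real^'m"
    proof -
      have "(\<Prod>i\<in>UNIV. ennreal (g i (\<eta> $ i))) = (\<Prod>i\<in>{j}. ennreal (g i (\<eta> $ i)))"
        by (rule prod.mono_neutral_right) (auto simp: g_def)
      then show ?thesis by (simp add: g_def)
    qed
    have "integrable lborel (\<lambda>t. normal_density 0 \<delta> t * g i t)" for i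
      using integrable_normal_moment[OF assms, of 0 2] assms by (cases "i = j") (auto simp: g_def)
    then have fin: "(\<integral>\<^sup>+t. ennreal (normal_density 0 \<delta> t * g i t) \<partial>lborel) \<noteq> top" for i
      by (subst nn_integral_eq_integral) (auto simp: g_def)
    moreover have [measurable]: "g i \<in> borel_measurable borel" for i
      unfolding g_def by measurable
    ultimately have "(\<integral>\<^sup>+\<eta>. (\<Prod>i\<in>UNIV. ennreal (g i (\<eta> $ i))) \<partial>(noise_measure \<delta> :: (real^'m) measure)) < top"
      by (subst nn_integral_noise_measure_prod)
        (simp_all add: less_top[symmetric] ennreal_prod_eq_top fin, simp add: g_def)
    then show "(\<integral>\<^sup>+\<eta>. ennreal (norm ((\<eta> $ j)\<^sup>2)) \<partial>(noise_measure \<delta> :: (real^'m) measure)) < \<infinity>"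
      by (simp add: g_prod)
  qed measurable
  then have "integrable (noise_measure \<delta> :: (real^'m) measure) (\<lambda>\<eta>. \<Sum>j\<in>UNIV. (\<eta> $ j)\<^sup>2)"
    by (rule Bochner_Integration.integrable_sum)
  then show ?thesis
    by (simp add: norm_vec_def L2_set_def sum_nonneg)
qed

text \<open>The Gaussian density is even, so reflection turns the integral into its own negative.
  This removes the cross term between signal and noise.\<close>

lemma integral_noise_measure_odd:
  fixes f :: "real^'m \<Rightarrow> 'b::{banach, second_countable_topology}"
  assumes [measurable]: "f \<in> borel_measurable borel" and odd: "\<And>\<eta>. f (- \<eta>) = - f \<eta>"
  shows "(\<integral>\<eta>. f \<eta> \<partial>noise_measure \<delta>) = 0"
proof -
  define w where "w \<eta> = (\<Prod>i\<in>UNIV. normal_density 0 \<delta> (\<eta> $ i))" for \<eta> :: "real^'m"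
  have [measurable]: "w \<in> borel_measurable borel" unfolding w_def by measurable
  have even: "w (- \<eta>) = w \<eta>" for \<eta> by (simp add: w_def normal_density_def)
  have eq: "(\<integral>\<eta>. f \<eta> \<partial>noise_measure \<delta>) = (\<integral>\<eta>. w \<eta> *\<^sub>R f \<eta> \<partial>lborel)"
    unfolding noise_measure_def w_def[symmetric]
    by (rule integral_density) (auto simp: w_def prod_nonneg)
  also have "\<dots> = (\<integral>\<eta>. w (- \<eta>) *\<^sub>R f (- \<eta>) \<partial>lborel)"
    by (rule lborel_integral_uminus[symmetric]) measurable
  also have "\<dots> = - (\<integral>\<eta>. w \<eta> *\<^sub>R f \<eta> \<partial>lborel)"
    by (simp add: even odd)
  finally have "(\<integral>\<eta>. f \<eta> \<partial>noise_measure \<delta>) = - (\<integral>\<eta>. f \<eta> \<partial>noise_measure \<delta>)"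
    by (simp add: eq)
  then have "2 *\<^sub>R (\<integral>\<eta>. f \<eta> \<partial>noise_measure \<delta>) = 0"
    by (metis add.right_inverse scaleR_2)
  then show ?thesis by simp
qed

section \<open>The divergence loss under the joint law\<close>

lemma joint_law_measurable:
  assumes "linear A"
  shows "(\<lambda>(x, \<eta>). (x, adjoint A (A x + \<eta>)))
    \<in> measurable (prior_measure p \<Otimes>\<^sub>M noise_measure \<delta>) (borel \<Otimes>\<^sub>M borel)"
proof -
  have [measurable]: "A \<in> borel_measurable borel" "adjoint A \<in> borel_measurable borel"
    using assms adjoint_linear[OF assms]
    by (auto intro!: borel_measurable_continuous_onI linear_continuous_on simp: linear_linear)
  show ?thesis by measurable
qed

text \<open>Pulling back along the sampling map replaces the joint law by a product measure, where
  Fubini's theorem applies.\<close>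

lemma integrable_joint_law_iff:
  fixes f :: "_ \<Rightarrow> real"
  assumes "linear A" "f \<in> borel_measurable (borel \<Otimes>\<^sub>M borel)"
  shows "integrable (joint_law A \<delta> p) f \<longleftrightarrow>
    integrable (prior_measure p \<Otimes>\<^sub>M noise_measure \<delta>) (\<lambda>z. f (fst z, adjoint A (A (fst z) + snd z)))"
  unfolding joint_law_def
  by (subst integrable_distr_eq[OF joint_law_measurable[OF assms(1)] assms(2)])
    (simp add: case_prod_unfold)

lemma integral_joint_law:
  fixes f :: "_ \<Rightarrow> real"
  assumes "linear A" "f \<in> borel_measurable (borel \<Otimes>\<^sub>M borel)"
  shows "integral\<^sup>L (joint_law A \<delta> p) f =
    (\<integral>z. f (fst z, adjoint A (A (fst z) + snd z)) \<partial>(prior_measure p \<Otimes>\<^sub>M noise_measure \<delta>))"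
  unfolding joint_law_def
  by (subst integral_distr[OF joint_law_measurable[OF assms(1)] assms(2)])
    (simp add: case_prod_unfold)

text \<open>In the expanded square the cross term is odd in the noise and integrates to zero; the
  remaining noise term is a constant independent of \<open>w\<close>.\<close>

lemma integral_noise_measure_norm_square_diff:
  fixes B :: "real^'m \<Rightarrow> real^'n"
  assumes "\<delta> > 0" "linear B"
  shows "integrable (noise_measure \<delta>) (\<lambda>\<eta>. (norm (w - B \<eta>))\<^sup>2)"
    and "(\<integral>\<eta>. (norm (w - B \<eta>))\<^sup>2 \<partial>noise_measure \<delta>) =
      (norm w)\<^sup>2 + (\<integral>\<eta>. (norm (B \<eta>))\<^sup>2 \<partial>noise_measure \<delta>)"
proof -
  interpret prob_space "noise_measure \<delta> :: (real^'m) measure"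
    by (rule prob_space_noise_measure[OF assms(1)])
  have [measurable]: "B \<in> borel_measurable borel"
    using assms(2) by (auto intro!: borel_measurable_continuous_onI linear_continuous_on simp: linear_linear)
  obtain K where K: "\<And>\<eta>. norm (B \<eta>) \<le> K * norm \<eta>"
    using linear_bounded[OF assms(2)] by auto
  have int_sq: "integrable (noise_measure \<delta>) (\<lambda>\<eta>. (norm (B \<eta>))\<^sup>2)"
  proof (rule Bochner_Integration.integrable_bound)
    show "integrable (noise_measure \<delta>) (\<lambda>\<eta>::real^'m. K\<^sup>2 * (norm \<eta>)\<^sup>2)"
      by (intro integrable_mult_right integrable_noise_measure_norm_square assms(1))
    show "AE \<eta> in noise_measure \<delta>. norm ((norm (B \<eta>))\<^sup>2) \<le> norm (K\<^sup>2 * (norm \<eta>)\<^sup>2)"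
    proof (rule AE_I2)
      fix \<eta> :: "real^'m"
      show "norm ((norm (B \<eta>))\<^sup>2) \<le> norm (K\<^sup>2 * (norm \<eta>)\<^sup>2)"
        using power_mono[OF K[of \<eta>] norm_ge_zero, of 2] by (simp add: power_mult_distrib abs_mult)
    qed
  qed measurable
  have int_inner: "integrable (noise_measure \<delta>) (\<lambda>\<eta>. w \<bullet> B \<eta>)"
    by (rule integrable_inner_of_square) (use int_sq in auto)
  have zero: "(\<integral>\<eta>. w \<bullet> B \<eta> \<partial>noise_measure \<delta>) = 0"
    by (rule integral_noise_measure_odd) (auto simp: linear_neg[OF assms(2)])
  have eq: "(norm (w - B \<eta>))\<^sup>2 = (norm w)\<^sup>2 - 2 * (w \<bullet> B \<eta>) + (norm (B \<eta>))\<^sup>2" for \<eta>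
    by (simp add: power2_norm_eq_inner inner_diff inner_commute)
  show "integrable (noise_measure \<delta>) (\<lambda>\<eta>. (norm (w - B \<eta>))\<^sup>2)"
    unfolding eq using int_inner int_sq by auto
  show "(\<integral>\<eta>. (norm (w - B \<eta>))\<^sup>2 \<partial>noise_measure \<delta>) =
      (norm w)\<^sup>2 + (\<integral>\<eta>. (norm (B \<eta>))\<^sup>2 \<partial>noise_measure \<delta>)"
    unfolding eq using int_inner int_sq zero by (simp add: prob_space[simplified])
qed

text \<open>Fubini's theorem integrates out the noise, which contributes only the constant
  \<open>c0 / 2\<close>, and transfers integrability from the joint law to the prior.\<close>

lemma div_loss_eq_prior_integral:
  fixes A :: "real^'n \<Rightarrow> real^'m" and \<phi> :: "real^'n \<Rightarrow> real^'n"
  assumes A: "linear A" and \<delta>: "\<delta> > 0" and prob: "prob_space (prior_measure p)"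
    and \<phi>: "\<phi> \<in> div_loss_class A \<delta> p"
  defines "c0 \<equiv> (\<integral>\<eta>. (norm (adjoint A \<eta>))\<^sup>2 \<partial>(noise_measure \<delta> :: (real^'m) measure))"
  shows "integrable (prior_measure p) (\<lambda>x. (norm (\<phi> x - adjoint A (A x)))\<^sup>2)"
    and "integrable (prior_measure p) (divergence \<phi>)"
    and "div_loss A \<delta> \<delta>' p \<phi> =
      1 / 2 * (\<integral>x. (norm (\<phi> x - adjoint A (A x)))\<^sup>2 \<partial>prior_measure p) + c0 / 2
      - \<delta>'\<^sup>2 * (\<integral>x. divergence \<phi> x \<partial>prior_measure p)"
proof -
  interpret Pr: prob_space "prior_measure p" by fact
  interpret N: prob_space "noise_measure \<delta> :: (real^'m) measure"
    by (rule prob_space_noise_measure[OF \<delta>])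
  interpret pair_prob_space "prior_measure p" "noise_measure \<delta> :: (real^'m) measure" ..
  have \<phi>1: "\<And>x. \<phi> differentiable (at x)" "continuous_on UNIV (\<lambda>x. jacobian \<phi> (at x))"
    and int: "integrable (joint_law A \<delta> p) (\<lambda>(x, z). (norm (\<phi> x - z))\<^sup>2)"
      "integrable (joint_law A \<delta> p) (\<lambda>(x, z). divergence \<phi> x)"
    using \<phi> unfolding div_loss_class_def by auto
  have [measurable]: "\<phi> \<in> borel_measurable borel"
    using \<phi>1(1) by (intro borel_measurable_continuous_onI continuous_at_imp_continuous_on)
      (auto intro: differentiable_imp_continuous_within)
  have [measurable]: "divergence \<phi> \<in> borel_measurable borel"
    by (intro borel_measurable_continuous_onI continuous_on_divergence \<phi>1)
  define w where "w x = \<phi> x - adjoint A (A x)" for x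
  note adj = adjoint_linear[OF A]
  have w: "\<phi> x - adjoint A (A x + \<eta>) = w x - adjoint A \<eta>" for x \<eta>
    by (simp add: w_def linear_add[OF adj])
  note noise = integral_noise_measure_norm_square_diff[OF \<delta> adj]
  have int1: "integrable (prior_measure p \<Otimes>\<^sub>M noise_measure \<delta>) (\<lambda>z. (norm (w (fst z) - adjoint A (snd z)))\<^sup>2)"
    using int(1) by (subst (asm) integrable_joint_law_iff[OF A]) (auto simp: w)
  have int2: "integrable (prior_measure p \<Otimes>\<^sub>M (noise_measure \<delta> :: (real^'m) measure)) (\<lambda>z. divergence \<phi> (fst z))"
    using int(2) by (subst (asm) integrable_joint_law_iff[OF A]) auto
  \<comment> \<open>This is the inner integral over the noise; the constant \<open>c0\<close> is
    integrable under a probability measure and can be subtracted.\<close>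
  have "integrable (prior_measure p) (\<lambda>x. (norm (w x))\<^sup>2 + c0)"
    using integrable_fst'[OF int1] by (simp add: noise c0_def)
  then have int_w: "integrable (prior_measure p) (\<lambda>x. (norm (w x))\<^sup>2)"
    using Bochner_Integration.integrable_diff[of _ "\<lambda>x. (norm (w x))\<^sup>2 + c0" "\<lambda>_. c0"] by simp
  then show "integrable (prior_measure p) (\<lambda>x. (norm (\<phi> x - adjoint A (A x)))\<^sup>2)"
    by (simp add: w_def)
  show int_div: "integrable (prior_measure p) (divergence \<phi>)"
    using integrable_fst'[OF int2] by (simp add: N.prob_space[simplified])
  let ?g = "\<lambda>z. 1 / 2 * (norm (w (fst z) - adjoint A (snd z)))\<^sup>2 - \<delta>'\<^sup>2 * divergence \<phi> (fst z)"
  have int_g: "integrable (prior_measure p \<Otimes>\<^sub>M noise_measure \<delta>) ?g"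
    using int1 int2 by auto
  have "div_loss A \<delta> \<delta>' p \<phi> = integral\<^sup>L (prior_measure p \<Otimes>\<^sub>M noise_measure \<delta>) ?g"
    unfolding div_loss_def by (subst integral_joint_law[OF A]) (auto simp: w)
  also have "\<dots> = (\<integral>x. (\<integral>\<eta>. ?g (x, \<eta>) \<partial>noise_measure \<delta>) \<partial>prior_measure p)"
    by (rule integral_fst'[OF int_g, symmetric])
  also have "\<dots> = (\<integral>x. 1 / 2 * ((norm (w x))\<^sup>2 + c0) - \<delta>'\<^sup>2 * divergence \<phi> x \<partial>prior_measure p)"
    using noise by (intro Bochner_Integration.integral_cong refl) (simp add: c0_def N.prob_space[simplified])
  also have "\<dots> = 1 / 2 * (\<integral>x. (norm (w x))\<^sup>2 \<partial>prior_measure p) + c0 / 2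
      - \<delta>'\<^sup>2 * (\<integral>x. divergence \<phi> x \<partial>prior_measure p)"
    using int_w int_div by (simp add: Pr.prob_space[simplified])
  finally show "div_loss A \<delta> \<delta>' p \<phi> =
      1 / 2 * (\<integral>x. (norm (\<phi> x - adjoint A (A x)))\<^sup>2 \<partial>prior_measure p) + c0 / 2
      - \<delta>'\<^sup>2 * (\<integral>x. divergence \<phi> x \<partial>prior_measure p)"
    by (simp add: w_def)
qed

text \<open>By parts, \<open>- \<integral> p div \<phi> = \<integral> p \<langle>grad (log p), \<phi>\<rangle>\<close>; completing the square then turns the
  divergence loss into the square loss.\<close>

lemma div_loss_eq_square_loss:
  fixes A :: "real^'n \<Rightarrow> real^'m" and p :: "real^'n \<Rightarrow> real"
  assumes A: "linear A" and \<delta>: "\<delta> > 0"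
    and ppos: "\<And>x. p x > 0" and pdiff: "\<And>x. p differentiable (at x)"
    and pcont: "continuous_on UNIV (grad p)"
    and prob: "prob_space (prior_measure p)"
    and int_x: "integrable (prior_measure p) (\<lambda>x. (norm x)\<^sup>2)"
    and int_score: "integrable (prior_measure p) (\<lambda>x. (norm (grad (\<lambda>u. ln (p u)) x))\<^sup>2)"
  shows "\<exists>c. \<forall>\<phi>\<in>div_loss_class A \<delta> p.
    \<phi> \<in> square_loss_class A \<delta>' p \<and> div_loss A \<delta> \<delta>' p \<phi> = square_loss A \<delta>' p \<phi> + c"
proof -
  interpret prob_space "prior_measure p" by fact
  define s where "s x = (1 / p x) *\<^sub>R grad p x" for x
  have s: "grad (\<lambda>u. ln (p u)) = s"
    using grad_eqI[OF GDERIV_ln[OF pdiff ppos]] by (simp add: fun_eq_iff s_def)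
  have gp: "GDERIV p x :> grad p x" for x by (rule differentiable_imp_GDERIV_grad[OF pdiff])
  have pc: "continuous_on UNIV p"
    using pdiff by (auto intro: continuous_at_imp_continuous_on differentiable_imp_continuous_within)
  have "continuous_on UNIV s"
    unfolding s_def using ppos by (intro continuous_intros pc pcont) (metis less_irrefl)
  then have [measurable]: "s \<in> borel_measurable borel" by (rule borel_measurable_continuous_onI)
  note adj = adjoint_linear[OF A]
  have cont_AA: "continuous_on UNIV (\<lambda>x. adjoint A (A x))"
    using linear_compose[OF A adj] by (auto intro!: linear_continuous_on simp: linear_linear comp_def)
  then have [measurable]: "(\<lambda>x. adjoint A (A x)) \<in> borel_measurable borel"
    by (rule borel_measurable_continuous_onI)
  obtain K where K: "\<And>x. norm (adjoint A (A x)) \<le> K * norm x"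
    using linear_bounded[OF linear_compose[OF A adj]] by (auto simp: comp_def)
  have int_AA: "integrable (prior_measure p) (\<lambda>x. (norm (adjoint A (A x)))\<^sup>2)"
  proof (rule Bochner_Integration.integrable_bound)
    show "integrable (prior_measure p) (\<lambda>x. K\<^sup>2 * (norm x)\<^sup>2)"
      by (intro integrable_mult_right int_x)
    show "AE x in prior_measure p. norm ((norm (adjoint A (A x)))\<^sup>2) \<le> norm (K\<^sup>2 * (norm x)\<^sup>2)"
    proof (rule AE_I2)
      fix x
      show "norm ((norm (adjoint A (A x)))\<^sup>2) \<le> norm (K\<^sup>2 * (norm x)\<^sup>2)"
        using power_mono[OF K[of x] norm_ge_zero, of 2] by (simp add: power_mult_distrib abs_mult)
    qed
  qed measurable
  have int_s: "integrable (prior_measure p) (\<lambda>x. (norm (s x))\<^sup>2)" using int_score by (simp add: s)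
  have int_sAA: "integrable (prior_measure p) (\<lambda>x. s x \<bullet> adjoint A (A x))"
    by (rule integrable_inner_of_square) (use int_s int_AA in auto)
  define c0 where "c0 = (\<integral>\<eta>. (norm (adjoint A \<eta>))\<^sup>2 \<partial>(noise_measure \<delta> :: (real^'m) measure))"
  \<comment> \<open>The constant collects the noise energy, the part left when \<phi> is split into
    \<open>w\<close> plus \<open>adjoint A (A x)\<close> in its pairing with the score, and the
    score term that completes the square.\<close>
  define c where "c = c0 / 2 + \<delta>'\<^sup>2 * (\<integral>x. s x \<bullet> adjoint A (A x) \<partial>prior_measure p)
    - \<delta>' ^ 4 / 2 * (\<integral>x. (norm (s x))\<^sup>2 \<partial>prior_measure p)"
  have "\<phi> \<in> square_loss_class A \<delta>' p \<and> div_loss A \<delta> \<delta>' p \<phi> = square_loss A \<delta>' p \<phi> + c"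
    if \<phi>: "\<phi> \<in> div_loss_class A \<delta> p" for \<phi>
  proof -
    have \<phi>1: "\<And>x. \<phi> differentiable (at x)" "continuous_on UNIV (\<lambda>x. jacobian \<phi> (at x))"
      using \<phi> unfolding div_loss_class_def by auto
    have \<phi>c: "continuous_on UNIV \<phi>"
      using \<phi>1(1) by (auto intro: continuous_at_imp_continuous_on differentiable_imp_continuous_within)
    then have [measurable]: "\<phi> \<in> borel_measurable borel" by (rule borel_measurable_continuous_onI)
    define w where "w x = \<phi> x - adjoint A (A x)" for x
    have [measurable]: "w \<in> borel_measurable borel" unfolding w_def by measurable
    note loss = div_loss_eq_prior_integral[OF A \<delta> prob \<phi>, folded w_def c0_def]
    have int_ww: "integrable (prior_measure p) (\<lambda>x. (norm (w x))\<^sup>2)" by (rule loss(1))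
    have int_wAA: "integrable (prior_measure p) (\<lambda>x. w x \<bullet> adjoint A (A x))"
      by (rule integrable_inner_of_square) (use int_ww int_AA in auto)
    have int_sw: "integrable (prior_measure p) (\<lambda>x. s x \<bullet> w x)"
      by (rule integrable_inner_of_square) (use int_ww int_s in auto)
    \<comment> \<open>So far only the deviation \<open>w\<close> is known to be square integrable;
      the second moment of the prior extends this to \<phi> itself, as the integration by parts
      demands.\<close>
    have "(norm (\<phi> x))\<^sup>2 = (norm (w x))\<^sup>2 + 2 * (w x \<bullet> adjoint A (A x)) + (norm (adjoint A (A x)))\<^sup>2" for x
      unfolding w_def power2_norm_eq_inner by (simp add: inner_diff inner_commute)
    then have int_\<phi>: "integrable (prior_measure p) (\<lambda>x. (norm (\<phi> x))\<^sup>2)"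
      using int_ww int_wAA int_AA by simp
    have parts: "(\<integral>x. divergence \<phi> x \<partial>prior_measure p) = - (\<integral>x. s x \<bullet> \<phi> x \<partial>prior_measure p)"
      unfolding s_def
      by (rule integral_divergence_prior[OF gp pcont ppos \<phi>1 prob loss(2) int_\<phi>])
        (use int_s in \<open>simp add: s_def\<close>)
    have "(\<integral>x. s x \<bullet> \<phi> x \<partial>prior_measure p) = (\<integral>x. s x \<bullet> w x + s x \<bullet> adjoint A (A x) \<partial>prior_measure p)"
      by (simp add: w_def inner_diff)
    then have s\<phi>: "(\<integral>x. s x \<bullet> \<phi> x \<partial>prior_measure p) =
        (\<integral>x. s x \<bullet> w x \<partial>prior_measure p) + (\<integral>x. s x \<bullet> adjoint A (A x) \<partial>prior_measure p)"
      using int_sw int_sAA by simp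
    have sq: "1 / 2 * (norm (\<phi> x - reg_forward A \<delta>' p x))\<^sup>2 =
        1 / 2 * (norm (w x))\<^sup>2 + \<delta>'\<^sup>2 * (s x \<bullet> w x) + \<delta>' ^ 4 / 2 * (norm (s x))\<^sup>2" for x
    proof -
      have "\<phi> x - reg_forward A \<delta>' p x = w x + \<delta>'\<^sup>2 *\<^sub>R s x"
        by (simp add: reg_forward_def s w_def)
      moreover have "(norm (w x + \<delta>'\<^sup>2 *\<^sub>R s x))\<^sup>2 =
          (norm (w x))\<^sup>2 + 2 * (\<delta>'\<^sup>2 * (s x \<bullet> w x)) + \<delta>'\<^sup>2 * \<delta>'\<^sup>2 * (norm (s x))\<^sup>2"
        unfolding power2_norm_eq_inner by (simp add: inner_add inner_commute)
      ultimately show ?thesis by (simp add: algebra_simps flip: power_add)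
    qed
    have "integrable (prior_measure p) (\<lambda>x. 1 / 2 * (norm (\<phi> x - reg_forward A \<delta>' p x))\<^sup>2)"
      unfolding sq using int_ww int_sw int_s by auto
    then have "\<phi> \<in> square_loss_class A \<delta>' p"
      unfolding square_loss_class_def using \<phi>c by blast
    moreover have "square_loss A \<delta>' p \<phi> = 1 / 2 * (\<integral>x. (norm (w x))\<^sup>2 \<partial>prior_measure p)
        + \<delta>'\<^sup>2 * (\<integral>x. s x \<bullet> w x \<partial>prior_measure p) + \<delta>' ^ 4 / 2 * (\<integral>x. (norm (s x))\<^sup>2 \<partial>prior_measure p)"
      unfolding square_loss_def sq using int_ww int_sw int_s by simp
    ultimately show ?thesis
      by (simp add: loss(3) parts s\<phi> c_def algebra_simps)
  qed
  then show ?thesis by blast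
qed

section \<open>Minimizers of the square loss and the MAP estimate\<close>

lemma square_loss_eq_0_iff:
  assumes ppos: "\<And>x. p x > 0" and pc: "continuous_on UNIV p"
    and T: "continuous_on UNIV (reg_forward A \<delta> p)" and \<phi>: "\<phi> \<in> square_loss_class A \<delta> p"
  shows "square_loss A \<delta> p \<phi> = 0 \<longleftrightarrow> \<phi> = reg_forward A \<delta> p"
proof
  assume "square_loss A \<delta> p \<phi> = 0"
  then have "AE x in prior_measure p. 1 / 2 * (norm (\<phi> x - reg_forward A \<delta> p x))\<^sup>2 = 0"
    using \<phi> unfolding square_loss_def square_loss_class_def
    by (subst integral_nonneg_eq_0_iff_AE[symmetric]) auto
  moreover have "p \<in> borel_measurable borel" by (rule borel_measurable_continuous_onI[OF pc])
  \<comment> \<open>Positivity of the density makes null sets of the prior null for Lebesgue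
    measure.\<close>
  ultimately have "AE x in lborel. \<phi> x = reg_forward A \<delta> p x"
    using ppos unfolding prior_measure_def by (subst (asm) AE_density) auto
  \<comment> \<open>A closed set of full Lebesgue measure is the whole space.\<close>
  moreover have "closed {x. \<phi> x = reg_forward A \<delta> p x}"
    using \<phi> T unfolding square_loss_class_def by (intro closed_Collect_eq) auto
  ultimately have "\<phi> x = reg_forward A \<delta> p x" for x
    using mem_closed_if_AE_lebesgue[of "{x. \<phi> x = reg_forward A \<delta> p x}" x]
    by (auto intro: AE_completion)
  then show "\<phi> = reg_forward A \<delta> p" by blast
qed (simp add: square_loss_def)

text \<open>The operator itself belongs to the class and has loss 0, and losses are nonnegative, so
  the minimizers are exactly the maps of zero loss.\<close>

lemma is_arg_min_square_loss:
  assumes ppos: "\<And>x. p x > 0" and pc: "continuous_on UNIV p"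
    and T: "continuous_on UNIV (reg_forward A \<delta> p)"
  shows "is_arg_min (square_loss A \<delta> p) (\<lambda>\<phi>. \<phi> \<in> square_loss_class A \<delta> p) \<phi>
    \<longleftrightarrow> \<phi> = reg_forward A \<delta> p"
proof -
  have mem: "reg_forward A \<delta> p \<in> square_loss_class A \<delta> p"
    using T by (simp add: square_loss_class_def)
  have nonneg: "square_loss A \<delta> p \<psi> \<ge> 0" for \<psi>
    by (simp add: square_loss_def)
  show ?thesis
    using mem nonneg square_loss_eq_0_iff[OF ppos pc T]
    unfolding is_arg_min_linorder by (metis order_antisym)
qed

theorem corollary1:
  fixes A :: "real^'n \<Rightarrow> real^'m"
    and p :: "real^'n \<Rightarrow> real"
    and \<delta> \<delta>' :: real
  assumes "linear A"
    and "\<delta> > 0"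
    and "\<delta>' = \<delta>"
    and "\<And>x. p x > 0"
    and "\<And>x. p differentiable (at x)"
    and "continuous_on UNIV (grad p)"
    and "prob_space (prior_measure p)"
    and "strongly_log_concave p"
    and "integrable (prior_measure p) (\<lambda>x. (norm x)\<^sup>2)"
    and "integrable (prior_measure p) (\<lambda>x. (norm (grad (\<lambda>u. ln (p u)) x))\<^sup>2)"
  shows
    "(\<forall>y.
        strongly_convex (map_objective A \<delta> p y) \<and>
        (\<exists>!x. is_arg_min (map_objective A \<delta> p y) (\<lambda>x. True) x) \<and>
        (\<forall>x. map_objective A \<delta> p y differentiable (at x) \<and>
             (grad (map_objective A \<delta> p y) x = 0 \<longleftrightarrow>
              adjoint A (A x) - \<delta>\<^sup>2 *\<^sub>R grad (\<lambda>u. ln (p u)) x = adjoint A y)) \<and>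
        (\<forall>x. adjoint A (A x) - \<delta>\<^sup>2 *\<^sub>R grad (\<lambda>u. ln (p u)) x = adjoint A y \<longrightarrow>
             x = x_MAP A \<delta> p y)) \<and>
     bij (reg_forward A \<delta> p) \<and>
     (\<exists>c. \<forall>\<phi>\<in>div_loss_class A \<delta> p.
        \<phi> \<in> square_loss_class A \<delta>' p \<and> div_loss A \<delta> \<delta>' p \<phi> = square_loss A \<delta>' p \<phi> + c) \<and>
     (\<exists>!\<phi>. is_arg_min (square_loss A \<delta>' p) (\<lambda>\<phi>. \<phi> \<in> square_loss_class A \<delta>' p) \<phi>) \<and>
     bij (phi_div A \<delta>' p) \<and>
     (\<forall>y. inv (phi_div A \<delta>' p) (adjoint A y) = x_MAP A \<delta> p y)"
proof -
  note A = assms(1) and ppos = assms(4) and pdiff = assms(5) and pcont = assms(6)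
  let ?T = "reg_forward A \<delta> p"
  have sc: "strongly_convex (map_objective A \<delta> p y)" for y
    using assms(1,2,8) by (rule strongly_convex_map_objective)
  have deriv: "GDERIV (map_objective A \<delta> p y) x :> ?T x - adjoint A y" for x y
    by (rule GDERIV_map_objective[OF A pdiff ppos])
  \<comment> \<open>For data \<open>y = 0\<close> the term \<open>adjoint A y\<close> vanishes and
    the gradient of the objective is \<open>?T\<close> itself.\<close>
  have bij: "bij ?T"
    using strongly_convex_bij_gradient[OF sc[of 0] deriv]
      linear_0[OF adjoint_linear[OF A]] by simp
  have arg_min: "is_arg_min (map_objective A \<delta> p y) (\<lambda>x. True) u \<longleftrightarrow> u = x"
    and MAP: "x_MAP A \<delta> p y = x" if "?T x = adjoint A y" for x y u
    using is_arg_min_unique_critical[OF sc, of y x u] arg_min_eq_critical[OF sc, of y x]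
      deriv[of y x] that by (auto simp: x_MAP_def)
  \<comment> \<open>Bijectivity provides a solution of the first-order condition for every
    \<open>y\<close>, and any such solution is the MAP estimate.\<close>
  have MAP_inv: "x_MAP A \<delta> p y = inv ?T (adjoint A y)" for y
    by (rule MAP) (simp add: surj_f_inv_f bij_is_surj[OF bij])
  have pc: "continuous_on UNIV p"
    using pdiff by (auto intro: continuous_at_imp_continuous_on differentiable_imp_continuous_within)
  have Tcont: "continuous_on UNIV ?T"
  proof -
    have "continuous_on UNIV (\<lambda>x. adjoint A (A x))"
      using linear_compose[OF A adjoint_linear[OF A]]
      by (auto intro!: linear_continuous_on simp: linear_linear comp_def)
    moreover have "continuous_on UNIV (\<lambda>x. (1 / p x) *\<^sub>R grad p x)"
      using ppos by (intro continuous_intros pc pcont) (metis less_irrefl)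
    ultimately show ?thesis
      unfolding reg_forward_def[abs_def] grad_eqI[OF GDERIV_ln[OF pdiff ppos]]
      by (intro continuous_on_diff continuous_on_scaleR[OF continuous_on_const])
  qed
  \<comment> \<open>The hypothesis \<open>\<delta>' = \<delta>\<close> enters here: the target of
    the square loss becomes the operator \<open>?T\<close> of the MAP problem.\<close>
  have sq_min: "is_arg_min (square_loss A \<delta>' p) (\<lambda>\<phi>. \<phi> \<in> square_loss_class A \<delta>' p) \<phi> \<longleftrightarrow> \<phi> = ?T" for \<phi>
    unfolding \<open>\<delta>' = \<delta>\<close> by (rule is_arg_min_square_loss[OF ppos pc Tcont])
  have phi: "phi_div A \<delta>' p = ?T"
    unfolding phi_div_def arg_min_def sq_min by simp
  have crit: "adjoint A (A x) - \<delta>\<^sup>2 *\<^sub>R grad (\<lambda>u. ln (p u)) x = ?T x" for x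
    by (simp add: reg_forward_def)
  show ?thesis
    \<comment> \<open>Read backwards, \<open>MAP_inv\<close> turns
      \<open>inv ?T (adjoint A y)\<close> into the MAP estimate, so the last conjunct becomes
      reflexive.\<close>
    unfolding crit sq_min phi MAP_inv[symmetric]
  proof (intro conjI allI impI)
    fix y x
    show "strongly_convex (map_objective A \<delta> p y)" by (rule sc)
    show "\<exists>!x. is_arg_min (map_objective A \<delta> p y) (\<lambda>x. True) x"
      using arg_min[of "inv ?T (adjoint A y)" y] surj_f_inv_f[OF bij_is_surj[OF bij]] by simp
    show "map_objective A \<delta> p y differentiable (at x)"
      using deriv unfolding gderiv_def by (rule differentiableI)
    show "grad (map_objective A \<delta> p y) x = 0 \<longleftrightarrow> ?T x = adjoint A y"
      by (simp add: grad_eqI[OF deriv])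
    show "x = x_MAP A \<delta> p y" if "?T x = adjoint A y" using MAP[OF that] by simp
    show "\<exists>c. \<forall>\<phi>\<in>div_loss_class A \<delta> p.
        \<phi> \<in> square_loss_class A \<delta>' p \<and> div_loss A \<delta> \<delta>' p \<phi> = square_loss A \<delta>' p \<phi> + c"
      using assms(1,2,4-7,9,10) by (rule div_loss_eq_square_loss)
  qed (use bij in auto)
qed

end
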